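(* Let $\mathcal{A}=A\oplus P$ be a diolic algebra over $\mathbb{K}$ and assume that $\operatorname{rank}(P)\neq 1$. Let $D(\mathcal{A})=\bigoplus_{g\in\mathbb{Z}}D(\mathcal{A})_g$ be the module of $\mathbb{Z}$-graded derivations of $\mathcal{A}$. Then: (i) the elements $X_0$ of $D(\mathcal{A})_0$ are the pairs $X_0=(X_0^A,X_0^P)$, where $X_0^A\in D(A)$ is a derivation of $A$ and $X_0^P:P\to P$ is a $\mathbb{K}$-linear operator such that $X_0^P(ap)=X_0^A(a)p+aX_0^P(p)$ for all $a\in A$, $p\in P$; (ii) the graded derivations of degree $1$ are the $P$-valued derivations of $A$, i.e. there is an isomorphism of $A$-modules $D(\mathcal{A})_1\cong D(A,P)$; (iii) all other graded derivations are trivial, i.e. $D(\mathcal{A})_g=0$ for $g\neq 0,1$.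
   Context: $\mathbb{K}$ is a field of characteristic $0$. A diolic algebra is a $\mathbb{Z}$-graded commutative $\mathbb{K}$-algebra $\mathcal{A}=\mathcal{A}_0\oplus\mathcal{A}_1$ with $\mathcal{A}_0=A$ a commutative unital $\mathbb{K}$-algebra, $\mathcal{A}_1=P$ an $A$-module, $\mathcal{A}_i=0$ for $i\ne 0,1$; the products are the multiplication of $A$, the module action $A\cdot P\subseteq P$, and $P\cdot P=0$. A graded derivation of degree $g$ of $\mathcal{A}$ is a $\mathbb{K}$-linear map $X:\mathcal{A}\to\mathcal{A}$ of degree $g$ (i.e. $X(\mathcal{A}_i)\subseteq\mathcal{A}_{i+g}$) with $X(ab)=X(a)b+(-1)^{g\deg a}aX(b)$ for homogeneous $a,b\in\mathcal{A}$; these form $D(\mathcal{A})_g$. For an $A$-module $Q$, $D(A,Q)$ is the $A$-module of $\mathbb{K}$-linear derivations $A\to Q$, and $D(A)=D(A,A)$. Restrictions of $X_g$ to $A$ and $P$ are denoted $X_g^A$, $X_g^P$. The rank of $P$ is the (constant) rank of $P$ as a finitely generated projective $A$-module (the rank of the vector bundle in the geometric case $A=C^\infty(M)$, $P=\Gamma(\pi)$). *)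

theory Defs
  imports "HOL-Algebra.Module" "HOL-Algebra.Ideal"
begin

section \<open>Linear maps and modules\<close>

definition char_zero :: "('k, 'm) ring_scheme \<Rightarrow> bool" where
  "char_zero K \<longleftrightarrow> (\<forall>n::nat. n > 0 \<longrightarrow> add_pow K n \<one>\<^bsub>K\<^esub> \<noteq> \<zero>\<^bsub>K\<^esub>)"

text \<open>All sets of maps below consist of extensional functions (undefined outside the carrier), so
  that equality of elements is equality of maps on the carrier.\<close>

definition linear_maps ::
  "('r, 'm) ring_scheme \<Rightarrow> ('r, 'b, 'x) module_scheme \<Rightarrow> ('r, 'c, 'y) module_scheme \<Rightarrow> ('b \<Rightarrow> 'c) set" where
  "linear_maps R M N = {f \<in> carrier M \<rightarrow>\<^sub>E carrier N.
     (\<forall>x\<in>carrier M. \<forall>y\<in>carrier M. f (x \<oplus>\<^bsub>M\<^esub> y) = f x \<oplus>\<^bsub>N\<^esub> f y) \<and>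
     (\<forall>r\<in>carrier R. \<forall>x\<in>carrier M. f (r \<odot>\<^bsub>M\<^esub> x) = r \<odot>\<^bsub>N\<^esub> f x)}"

definition module_isos ::
  "('r, 'm) ring_scheme \<Rightarrow> ('r, 'b, 'x) module_scheme \<Rightarrow> ('r, 'c, 'y) module_scheme \<Rightarrow> ('b \<Rightarrow> 'c) set" where
  "module_isos R M N = {f \<in> linear_maps R M N.
     module R M \<and> module R N \<and> bij_betw f (carrier M) (carrier N)}"

definition self_module :: "('a, 'm) ring_scheme \<Rightarrow> ('a, 'a) module" where
  "self_module R = \<lparr>carrier = carrier R, mult = mult R, one = one R, zero = zero R, add = add R,
     smult = mult R\<rparr>"

text \<open>Restriction of scalars along the structure map \<open>k \<mapsto> k \<cdot> 1\<close> of an algebra \<open>A\<close>.\<close>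

definition restrict_scalars ::
  "('k, 'a, 'x) module_scheme \<Rightarrow> ('a, 'b, 'y) module_scheme \<Rightarrow> ('k, 'b) module" where
  "restrict_scalars A M = \<lparr>carrier = carrier M, mult = mult M, one = one M, zero = zero M,
     add = add M, smult = (\<lambda>k x. (k \<odot>\<^bsub>A\<^esub> \<one>\<^bsub>A\<^esub>) \<odot>\<^bsub>M\<^esub> x)\<rparr>"

text \<open>The set \<open>F\<close> of functions \<open>S \<rightarrow> M\<close> with pointwise operations. As for every record below that
  is only used as a module, the ring fields \<open>mult\<close> and \<open>one\<close> are irrelevant.\<close>

definition pointwise_module ::
  "'s set \<Rightarrow> ('r, 'b, 'x) module_scheme \<Rightarrow> ('s \<Rightarrow> 'b) set \<Rightarrow> ('r, 's \<Rightarrow> 'b) module" where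
  "pointwise_module S M F = \<lparr>carrier = F, mult = undefined, one = undefined,
     zero = (\<lambda>x\<in>S. \<zero>\<^bsub>M\<^esub>), add = (\<lambda>f g. \<lambda>x\<in>S. f x \<oplus>\<^bsub>M\<^esub> g x),
     smult = (\<lambda>r f. \<lambda>x\<in>S. r \<odot>\<^bsub>M\<^esub> f x)\<rparr>"

definition free_module :: "('a, 'm) ring_scheme \<Rightarrow> nat \<Rightarrow> ('a, nat \<Rightarrow> 'a) module" where
  "free_module R n = pointwise_module {..<n} (self_module R) ({..<n} \<rightarrow>\<^sub>E carrier R)"

text \<open>Finitely generated projective: a direct summand of some \<open>R\<^sup>n\<close>, the splitting being given by
  a section \<open>i\<close> of a linear map \<open>q : R\<^sup>n \<rightarrow> M\<close>.\<close>

definition fg_projective :: "('a, 'm) ring_scheme \<Rightarrow> ('a, 'b, 'x) module_scheme \<Rightarrow> bool" where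
  "fg_projective R M \<longleftrightarrow> (\<exists>n. \<exists>i\<in>linear_maps R M (free_module R n).
     \<exists>q\<in>linear_maps R (free_module R n) M. \<forall>x\<in>carrier M. q (i x) = x)"

definition free_of_rank :: "('a, 'm) ring_scheme \<Rightarrow> ('a, 'b, 'x) module_scheme \<Rightarrow> nat \<Rightarrow> bool" where
  "free_of_rank R M n \<longleftrightarrow> (\<exists>e\<in>{..<n} \<rightarrow> carrier M. \<forall>x\<in>carrier M.
     \<exists>!c. c \<in> {..<n} \<rightarrow>\<^sub>E carrier R \<and> x = (\<Oplus>\<^bsub>M\<^esub>i\<in>{..<n}. c i \<odot>\<^bsub>M\<^esub> e i))"


section \<open>Localisation and rank\<close>

text \<open>\<open>S\<close> is a multiplicative subset of the base ring; \<open>(m, s)\<close> stands for the fraction \<open>m / s\<close>.\<close>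

definition frac_rel :: "('a, 'b, 'x) module_scheme \<Rightarrow> 'a set \<Rightarrow> (('b \<times> 'a) \<times> ('b \<times> 'a)) set" where
  "frac_rel M S = {((m, s), (n, t)). m \<in> carrier M \<and> n \<in> carrier M \<and> s \<in> S \<and> t \<in> S \<and>
     (\<exists>u\<in>S. u \<odot>\<^bsub>M\<^esub> (t \<odot>\<^bsub>M\<^esub> m) = u \<odot>\<^bsub>M\<^esub> (s \<odot>\<^bsub>M\<^esub> n))}"

definition loc_frac :: "('a, 'b, 'x) module_scheme \<Rightarrow> 'a set \<Rightarrow> 'b \<Rightarrow> 'a \<Rightarrow> ('b \<times> 'a) set" where
  "loc_frac M S m s = frac_rel M S `` {(m, s)}"

text \<open>The operations on classes are unions over representatives; since the result does not depend
  on the representatives, each union is a single class.\<close>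

definition loc_module ::
  "('a, 'm) ring_scheme \<Rightarrow> ('a, 'b, 'x) module_scheme \<Rightarrow> 'a set \<Rightarrow> (('a \<times> 'a) set, ('b \<times> 'a) set) module" where
  "loc_module R M S = \<lparr>carrier = (carrier M \<times> S) // frac_rel M S,
     mult = undefined, one = undefined,
     zero = loc_frac M S \<zero>\<^bsub>M\<^esub> \<one>\<^bsub>R\<^esub>,
     add = (\<lambda>x y. \<Union>(m, s)\<in>x. \<Union>(n, t)\<in>y.
       loc_frac M S (t \<odot>\<^bsub>M\<^esub> m \<oplus>\<^bsub>M\<^esub> s \<odot>\<^bsub>M\<^esub> n) (s \<otimes>\<^bsub>R\<^esub> t)),
     smult = (\<lambda>c x. \<Union>(a, s)\<in>c. \<Union>(m, t)\<in>x. loc_frac M S (a \<odot>\<^bsub>M\<^esub> m) (s \<otimes>\<^bsub>R\<^esub> t))\<rparr>"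

definition loc_ring :: "('a, 'm) ring_scheme \<Rightarrow> 'a set \<Rightarrow> ('a \<times> 'a) set ring" where
  "loc_ring R S = (let L = loc_module R (self_module R) S in
     \<lparr>carrier = carrier L, mult = smult L, one = loc_frac (self_module R) S \<one>\<^bsub>R\<^esub> \<one>\<^bsub>R\<^esub>,
      zero = zero L, add = add L\<rparr>)"

text \<open>Over the zero ring, which has no prime ideals, every \<open>n\<close> is a rank of the (zero) module.\<close>

definition has_rank :: "('a, 'm) ring_scheme \<Rightarrow> ('a, 'b, 'x) module_scheme \<Rightarrow> nat \<Rightarrow> bool" where
  "has_rank R M n \<longleftrightarrow> fg_projective R M \<and>
     (\<forall>I. primeideal I R \<longrightarrow>
        free_of_rank (loc_ring R (carrier R - I)) (loc_module R M (carrier R - I)) n)"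


section \<open>Diolic algebras\<close>

text \<open>\<open>A \<oplus> P\<close> with \<open>P \<cdot> P = 0\<close>, as an \<open>A\<close>-algebra and as an algebra over the ground field.\<close>

definition diolic_over :: "('k, 'a, 'x) module_scheme \<Rightarrow> ('a, 'p, 'y) module_scheme \<Rightarrow> ('a, 'a \<times> 'p) module" where
  "diolic_over A P = \<lparr>carrier = carrier A \<times> carrier P,
     mult = (\<lambda>(a, p) (b, q). (a \<otimes>\<^bsub>A\<^esub> b, a \<odot>\<^bsub>P\<^esub> q \<oplus>\<^bsub>P\<^esub> b \<odot>\<^bsub>P\<^esub> p)),
     one = (\<one>\<^bsub>A\<^esub>, \<zero>\<^bsub>P\<^esub>),
     zero = (\<zero>\<^bsub>A\<^esub>, \<zero>\<^bsub>P\<^esub>),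
     add = (\<lambda>(a, p) (b, q). (a \<oplus>\<^bsub>A\<^esub> b, p \<oplus>\<^bsub>P\<^esub> q)),
     smult = (\<lambda>c (a, p). (c \<otimes>\<^bsub>A\<^esub> a, c \<odot>\<^bsub>P\<^esub> p))\<rparr>"

definition diolic :: "('k, 'a, 'x) module_scheme \<Rightarrow> ('a, 'p, 'y) module_scheme \<Rightarrow> ('k, 'a \<times> 'p) module" where
  "diolic A P = restrict_scalars A (diolic_over A P)"

definition diolic_component ::
  "('k, 'a, 'x) module_scheme \<Rightarrow> ('a, 'p, 'y) module_scheme \<Rightarrow> int \<Rightarrow> ('a \<times> 'p) set" where
  "diolic_component A P i =
     (if i = 0 then carrier A \<times> {\<zero>\<^bsub>P\<^esub>}
      else if i = 1 then {\<zero>\<^bsub>A\<^esub>} \<times> carrier P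
      else {(\<zero>\<^bsub>A\<^esub>, \<zero>\<^bsub>P\<^esub>)})"


section \<open>Derivations\<close>

definition derivations ::
  "('k, 'm) ring_scheme \<Rightarrow> ('k, 'a, 'x) module_scheme \<Rightarrow> ('a, 'q, 'y) module_scheme \<Rightarrow> ('a \<Rightarrow> 'q) set" where
  "derivations K A Q = {d \<in> linear_maps K A (restrict_scalars A Q).
     \<forall>a\<in>carrier A. \<forall>b\<in>carrier A. d (a \<otimes>\<^bsub>A\<^esub> b) = b \<odot>\<^bsub>Q\<^esub> d a \<oplus>\<^bsub>Q\<^esub> a \<odot>\<^bsub>Q\<^esub> d b}"

definition derivation_module ::
  "('k, 'm) ring_scheme \<Rightarrow> ('k, 'a, 'x) module_scheme \<Rightarrow> ('a, 'q, 'y) module_scheme \<Rightarrow> ('a, 'a \<Rightarrow> 'q) module" where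
  "derivation_module K A Q = pointwise_module (carrier A) Q (derivations K A Q)"

text \<open>\<open>(-1)\<^sup>n \<cdot> x\<close> for an integer exponent.\<close>

definition koszul :: "('b, 'm) ring_scheme \<Rightarrow> int \<Rightarrow> 'b \<Rightarrow> 'b" where
  "koszul B n x = (if even n then x else \<ominus>\<^bsub>B\<^esub> x)"

definition graded_derivations ::
  "('k, 'm) ring_scheme \<Rightarrow> ('k, 'b, 'x) module_scheme \<Rightarrow> (int \<Rightarrow> 'b set) \<Rightarrow> int \<Rightarrow> ('b \<Rightarrow> 'b) set" where
  "graded_derivations K B gr g = {X \<in> linear_maps K B B.
     (\<forall>i. X ` gr i \<subseteq> gr (i + g)) \<and>
     (\<forall>i j. \<forall>a\<in>gr i. \<forall>b\<in>gr j.
        X (a \<otimes>\<^bsub>B\<^esub> b) = X a \<otimes>\<^bsub>B\<^esub> b \<oplus>\<^bsub>B\<^esub> koszul B (g * i) (a \<otimes>\<^bsub>B\<^esub> X b))}"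

definition diolic_derivations ::
  "('k, 'm) ring_scheme \<Rightarrow> ('k, 'a, 'x) module_scheme \<Rightarrow> ('a, 'p, 'y) module_scheme \<Rightarrow> int
     \<Rightarrow> ('a \<times> 'p \<Rightarrow> 'a \<times> 'p) set" where
  "diolic_derivations K A P g = graded_derivations K (diolic A P) (diolic_component A P) g"

definition diolic_derivation_module ::
  "('k, 'm) ring_scheme \<Rightarrow> ('k, 'a, 'x) module_scheme \<Rightarrow> ('a, 'p, 'y) module_scheme \<Rightarrow> int
     \<Rightarrow> ('a, 'a \<times> 'p \<Rightarrow> 'a \<times> 'p) module" where
  "diolic_derivation_module K A P g =
     pointwise_module (carrier (diolic A P)) (diolic_over A P) (diolic_derivations K A P g)"

text \<open>Restrictions of a derivation \<open>X\<close> to \<open>A = A \<times> {0}\<close> and \<open>P = {0} \<times> P\<close>, with the target component named by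
  the last letter.\<close>

definition restr_AA ::
  "('k, 'a, 'x) module_scheme \<Rightarrow> ('a, 'p, 'y) module_scheme \<Rightarrow> ('a \<times> 'p \<Rightarrow> 'a \<times> 'p) \<Rightarrow> 'a \<Rightarrow> 'a" where
  "restr_AA A P X = (\<lambda>a\<in>carrier A. fst (X (a, \<zero>\<^bsub>P\<^esub>)))"

definition restr_AP ::
  "('k, 'a, 'x) module_scheme \<Rightarrow> ('a, 'p, 'y) module_scheme \<Rightarrow> ('a \<times> 'p \<Rightarrow> 'a \<times> 'p) \<Rightarrow> 'a \<Rightarrow> 'p" where
  "restr_AP A P X = (\<lambda>a\<in>carrier A. snd (X (a, \<zero>\<^bsub>P\<^esub>)))"

definition restr_PP ::
  "('k, 'a, 'x) module_scheme \<Rightarrow> ('a, 'p, 'y) module_scheme \<Rightarrow> ('a \<times> 'p \<Rightarrow> 'a \<times> 'p) \<Rightarrow> 'p \<Rightarrow> 'p" where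
  "restr_PP A P X = (\<lambda>p\<in>carrier P. snd (X (\<zero>\<^bsub>A\<^esub>, p)))"

end

theory Submission
  imports Defs
begin

text \<open>
  A derivation \<open>X\<close> of degree \<open>g\<close> of \<open>A \<oplus> P\<close> is determined by its restrictions to \<open>A\<close> (degree \<open>0\<close>) and
  to \<open>P\<close> (degree \<open>1\<close>), and these land in the components of degree \<open>g\<close> and \<open>g + 1\<close>, which vanish unless
  \<open>g\<close>, respectively \<open>g + 1\<close>, is \<open>0\<close> or \<open>1\<close>. So for \<open>g = 0\<close> both restrictions survive, for \<open>g = 1\<close> only
  the one \<open>A \<rightarrow> P\<close>, for \<open>g = -1\<close> only the one \<open>P \<rightarrow> A\<close>, and for every other \<open>g\<close> none. In degree \<open>0\<close> the graded
  Leibniz rule on \<open>A \<cdot> A\<close> and on \<open>A \<cdot> P\<close> is the condition on the pair of restrictions, in degree \<open>1\<close> its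
  instance on \<open>A \<cdot> A\<close> says that \<open>A \<rightarrow> P\<close> is a derivation, and its other instances have vanishing sides.

  The rank enters only in degree \<open>-1\<close>. There the Leibniz rule on \<open>A \<cdot> P\<close> says that \<open>\<phi> = X : P \<rightarrow> A\<close> is
  \<open>A\<close>-linear, and on \<open>P \<cdot> P = 0\<close>, where the Koszul sign is \<open>-1\<close>, it says \<open>\<phi>(p) q = \<phi>(q) p\<close> for all
  \<open>p, q\<close> (lemma \<open>degree_minus_one_form\<close>). On a free module with two distinct basis elements \<open>e\<^sub>1, e\<^sub>2\<close>
  the relation \<open>\<phi>(e\<^sub>1) e\<^sub>2 = \<phi>(e\<^sub>2) e\<^sub>1\<close> forces both coefficients to vanish, and on the zero module
  \<open>\<phi> = 0\<close> anyway; in rank \<open>1\<close> the relation would be automatic. To pass from the free to the locally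
  free case, suppose \<open>\<phi>(p) \<noteq> 0\<close>. The annihilator of \<open>\<phi>(p)\<close> is then a proper ideal, contained in some
  prime ideal \<open>I\<close> (lemma \<open>prime_above_ideal\<close>). The argument in the free module \<open>P\<^sub>I\<close> yields some
  \<open>u \<notin> I\<close> with \<open>u \<phi>(p) = 0\<close> (lemma \<open>proportional_form_loc_zero\<close>), which is a contradiction. The
  conclusion \<open>\<phi> = 0\<close> is the proposition \<open>proportional_form_zero\<close>.
\<close>

section \<open>Scalars\<close>

lemma (in cring) module_self_module: "module R (self_module R)"
proof (rule moduleI)
  show "abelian_group (self_module R)"
    by (rule abelian_groupI)
      (auto simp: self_module_def a_ac intro: l_neg bexI[of _ "\<ominus> _"])
qed (auto simp: self_module_def l_distr r_distr m_assoc is_cring)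

lemma (in module) smult_lcomm:
  assumes "a \<in> carrier R" "b \<in> carrier R" "x \<in> carrier M"
  shows "a \<odot>\<^bsub>M\<^esub> (b \<odot>\<^bsub>M\<^esub> x) = b \<odot>\<^bsub>M\<^esub> (a \<odot>\<^bsub>M\<^esub> x)"
  using assms by (metis R.m_comm smult_assoc1)

section \<open>Localisation of modules\<close>

text \<open>The localisation is handled through its fractions: equality, sum and scalar multiple of fractions
  are computed on representatives, so that the quotient construction does not appear afterwards.\<close>

locale localisation = module R M for R (structure) and M (structure) +
  fixes S :: "'a set"
  assumes denoms_subset: "S \<subseteq> carrier R"
    and one_denom: "\<one>\<^bsub>R\<^esub> \<in> S"
    and mult_denom: "\<lbrakk>s \<in> S; t \<in> S\<rbrakk> \<Longrightarrow> s \<otimes>\<^bsub>R\<^esub> t \<in> S"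
begin

lemma denom_carrier [simp]: "s \<in> S \<Longrightarrow> s \<in> carrier R"
  using denoms_subset by auto

lemma equiv_frac_rel: "equiv (carrier M \<times> S) (frac_rel M S)"
proof (rule equivI)
  show "frac_rel M S \<subseteq> (carrier M \<times> S) \<times> (carrier M \<times> S)"
    by (auto simp: frac_rel_def)
  show "refl_on (carrier M \<times> S) (frac_rel M S)"
    by (rule refl_onI) (use one_denom in \<open>auto simp: frac_rel_def\<close>)
  show "sym (frac_rel M S)"
    by (rule symI) (auto simp: frac_rel_def intro: sym)
  show "trans (frac_rel M S)"
  proof (rule transI, clarify)
    fix m s n t k r
    assume "((m, s), (n, t)) \<in> frac_rel M S" and "((n, t), (k, r)) \<in> frac_rel M S"
    then obtain u v where c: "m \<in> carrier M" "n \<in> carrier M" "k \<in> carrier M" "s \<in> S" "t \<in> S" "r \<in> S"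
      "u \<in> S" "v \<in> S" and u: "u \<odot>\<^bsub>M\<^esub> (t \<odot>\<^bsub>M\<^esub> m) = u \<odot>\<^bsub>M\<^esub> (s \<odot>\<^bsub>M\<^esub> n)"
      and v: "v \<odot>\<^bsub>M\<^esub> (r \<odot>\<^bsub>M\<^esub> n) = v \<odot>\<^bsub>M\<^esub> (t \<odot>\<^bsub>M\<^esub> k)"
      by (auto simp: frac_rel_def)
    have "(u \<otimes> v \<otimes> t) \<odot>\<^bsub>M\<^esub> (r \<odot>\<^bsub>M\<^esub> m) = v \<odot>\<^bsub>M\<^esub> (r \<odot>\<^bsub>M\<^esub> (u \<odot>\<^bsub>M\<^esub> (t \<odot>\<^bsub>M\<^esub> m)))"
      using c by (simp add: smult_assoc1 smult_lcomm)
    also have "\<dots> = u \<odot>\<^bsub>M\<^esub> (s \<odot>\<^bsub>M\<^esub> (v \<odot>\<^bsub>M\<^esub> (r \<odot>\<^bsub>M\<^esub> n)))"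
      unfolding u using c by (simp add: smult_lcomm)
    also have "\<dots> = (u \<otimes> v \<otimes> t) \<odot>\<^bsub>M\<^esub> (s \<odot>\<^bsub>M\<^esub> k)"
      unfolding v using c by (simp add: smult_assoc1 smult_lcomm)
    finally show "((m, s), (k, r)) \<in> frac_rel M S"
      using c mult_denom by (auto simp: frac_rel_def)
  qed
qed

lemma loc_frac_eqI:
  assumes "u \<odot>\<^bsub>M\<^esub> (t \<odot>\<^bsub>M\<^esub> m) = u \<odot>\<^bsub>M\<^esub> (s \<odot>\<^bsub>M\<^esub> n)" "u \<in> S"
    and "m \<in> carrier M" "n \<in> carrier M" "s \<in> S" "t \<in> S"
  shows "loc_frac M S m s = loc_frac M S n t"
  unfolding loc_frac_def
  by (rule equiv_class_eq[OF equiv_frac_rel]) (use assms in \<open>auto simp: frac_rel_def\<close>)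

lemma loc_frac_eqD:
  assumes "loc_frac M S m s = loc_frac M S n t"
    and "m \<in> carrier M" "n \<in> carrier M" "s \<in> S" "t \<in> S"
  obtains u where "u \<in> S" "u \<odot>\<^bsub>M\<^esub> (t \<odot>\<^bsub>M\<^esub> m) = u \<odot>\<^bsub>M\<^esub> (s \<odot>\<^bsub>M\<^esub> n)"
  using eq_equiv_class[OF assms(1)[unfolded loc_frac_def] equiv_frac_rel] assms
  by (auto simp: frac_rel_def)

lemma carrier_loc_module:
  "carrier (loc_module R M S) = {loc_frac M S m s | m s. m \<in> carrier M \<and> s \<in> S}"
  by (auto simp: loc_module_def loc_frac_def quotient_def)

lemma loc_fracE:
  assumes "x \<in> carrier (loc_module R M S)"
  obtains m s where "m \<in> carrier M" "s \<in> S" "x = loc_frac M S m s"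
  using assms carrier_loc_module by auto

lemma loc_frac_closed [simp]:
  "\<lbrakk>m \<in> carrier M; s \<in> S\<rbrakk> \<Longrightarrow> loc_frac M S m s \<in> carrier (loc_module R M S)"
  using carrier_loc_module by auto

lemma loc_zero: "\<zero>\<^bsub>loc_module R M S\<^esub> = loc_frac M S \<zero>\<^bsub>M\<^esub> \<one>\<^bsub>R\<^esub>"
  by (simp add: loc_module_def)

lemma loc_frac_zero: "s \<in> S \<Longrightarrow> loc_frac M S \<zero>\<^bsub>M\<^esub> s = \<zero>\<^bsub>loc_module R M S\<^esub>"
  unfolding loc_zero by (rule loc_frac_eqI[OF _ one_denom]) (auto simp: one_denom)

lemma loc_add:
  assumes "m \<in> carrier M" "s \<in> S" "n \<in> carrier M" "t \<in> S"
  shows "loc_frac M S m s \<oplus>\<^bsub>loc_module R M S\<^esub> loc_frac M S n t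
    = loc_frac M S (t \<odot>\<^bsub>M\<^esub> m \<oplus>\<^bsub>M\<^esub> s \<odot>\<^bsub>M\<^esub> n) (s \<otimes>\<^bsub>R\<^esub> t)"
proof -
  let ?f = "\<lambda>(m, s) (n, t). loc_frac M S (t \<odot>\<^bsub>M\<^esub> m \<oplus>\<^bsub>M\<^esub> s \<odot>\<^bsub>M\<^esub> n) (s \<otimes>\<^bsub>R\<^esub> t)"
  have cong: "congruent2 (frac_rel M S) (frac_rel M S) ?f"
  proof (rule congruent2I', clarify)
    fix m s m' s' n t n' t'
    assume "((m, s), (m', s')) \<in> frac_rel M S" and "((n, t), (n', t')) \<in> frac_rel M S"
    then obtain u v where c: "m \<in> carrier M" "n \<in> carrier M" "m' \<in> carrier M" "n' \<in> carrier M"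
      "s \<in> S" "t \<in> S" "s' \<in> S" "t' \<in> S" "u \<in> S" "v \<in> S"
      and u: "u \<odot>\<^bsub>M\<^esub> (s' \<odot>\<^bsub>M\<^esub> m) = u \<odot>\<^bsub>M\<^esub> (s \<odot>\<^bsub>M\<^esub> m')"
      and v: "v \<odot>\<^bsub>M\<^esub> (t' \<odot>\<^bsub>M\<^esub> n) = v \<odot>\<^bsub>M\<^esub> (t \<odot>\<^bsub>M\<^esub> n')"
      by (auto simp: frac_rel_def)
    have "(u \<otimes> v) \<odot>\<^bsub>M\<^esub> ((s' \<otimes> t') \<odot>\<^bsub>M\<^esub> (t \<odot>\<^bsub>M\<^esub> m \<oplus>\<^bsub>M\<^esub> s \<odot>\<^bsub>M\<^esub> n))
        = v \<odot>\<^bsub>M\<^esub> (t \<odot>\<^bsub>M\<^esub> (t' \<odot>\<^bsub>M\<^esub> (u \<odot>\<^bsub>M\<^esub> (s' \<odot>\<^bsub>M\<^esub> m))))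
          \<oplus>\<^bsub>M\<^esub> u \<odot>\<^bsub>M\<^esub> (s \<odot>\<^bsub>M\<^esub> (s' \<odot>\<^bsub>M\<^esub> (v \<odot>\<^bsub>M\<^esub> (t' \<odot>\<^bsub>M\<^esub> n))))"
      using c by (simp add: smult_assoc1 smult_r_distr smult_lcomm)
    also have "\<dots> = (u \<otimes> v) \<odot>\<^bsub>M\<^esub> ((s \<otimes> t) \<odot>\<^bsub>M\<^esub> (t' \<odot>\<^bsub>M\<^esub> m' \<oplus>\<^bsub>M\<^esub> s' \<odot>\<^bsub>M\<^esub> n'))"
      unfolding u v using c by (simp add: smult_assoc1 smult_r_distr smult_lcomm)
    finally show "loc_frac M S (t \<odot>\<^bsub>M\<^esub> m \<oplus>\<^bsub>M\<^esub> s \<odot>\<^bsub>M\<^esub> n) (s \<otimes>\<^bsub>R\<^esub> t)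
        = loc_frac M S (t' \<odot>\<^bsub>M\<^esub> m' \<oplus>\<^bsub>M\<^esub> s' \<odot>\<^bsub>M\<^esub> n') (s' \<otimes>\<^bsub>R\<^esub> t')"
      by (rule loc_frac_eqI) (use c mult_denom in auto)
  qed
  show ?thesis
    using UN_equiv_class2[OF equiv_frac_rel equiv_frac_rel cong, of "(m, s)" "(n, t)"] assms
    by (simp add: loc_module_def loc_frac_def case_prod_beta')
qed

text \<open>This is what makes finite sums in the localisation, and hence bases, meaningful.\<close>

lemma abelian_monoid_loc_module: "abelian_monoid (loc_module R M S)"
proof (rule abelian_monoidI)
  let ?L = "loc_module R M S"
  show "x \<oplus>\<^bsub>?L\<^esub> y \<in> carrier ?L" if "x \<in> carrier ?L" "y \<in> carrier ?L" for x y
    using that by (auto elim!: loc_fracE simp: loc_add mult_denom)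
  show "\<zero>\<^bsub>?L\<^esub> \<in> carrier ?L"
    by (simp add: loc_zero one_denom)
  show "(x \<oplus>\<^bsub>?L\<^esub> y) \<oplus>\<^bsub>?L\<^esub> z = x \<oplus>\<^bsub>?L\<^esub> (y \<oplus>\<^bsub>?L\<^esub> z)"
    if "x \<in> carrier ?L" "y \<in> carrier ?L" "z \<in> carrier ?L" for x y z
    using that
    by (auto elim!: loc_fracE simp: loc_add mult_denom smult_r_distr smult_assoc1 smult_lcomm
        M.add.m_assoc R.m_assoc)
  show "\<zero>\<^bsub>?L\<^esub> \<oplus>\<^bsub>?L\<^esub> x = x" if "x \<in> carrier ?L" for x
    using that by (auto elim!: loc_fracE simp: loc_add loc_zero one_denom)
  show "x \<oplus>\<^bsub>?L\<^esub> y = y \<oplus>\<^bsub>?L\<^esub> x" if "x \<in> carrier ?L" "y \<in> carrier ?L" for x y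
    using that by (auto elim!: loc_fracE simp: loc_add M.add.m_comm R.m_comm)
qed

lemma localisation_self_module: "localisation R (self_module R) S"
  by (intro localisation.intro localisation_axioms.intro module_self_module)
    (auto simp: denoms_subset one_denom mult_denom)

abbreviation ring_frac :: "'a \<Rightarrow> 'a \<Rightarrow> ('a \<times> 'a) set" where
  "ring_frac a s \<equiv> loc_frac (self_module R) S a s"

lemma carrier_loc_ring:
  "carrier (loc_ring R S) = {ring_frac a s | a s. a \<in> carrier R \<and> s \<in> S}"
  using localisation.carrier_loc_module[OF localisation_self_module]
  by (simp add: loc_ring_def Let_def self_module_def)

lemma ring_frac_closed [simp]:
  "\<lbrakk>a \<in> carrier R; s \<in> S\<rbrakk> \<Longrightarrow> ring_frac a s \<in> carrier (loc_ring R S)"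
  using carrier_loc_ring by auto

lemma loc_smult:
  assumes "a \<in> carrier R" "s \<in> S" "m \<in> carrier M" "t \<in> S"
  shows "ring_frac a s \<odot>\<^bsub>loc_module R M S\<^esub> loc_frac M S m t
    = loc_frac M S (a \<odot>\<^bsub>M\<^esub> m) (s \<otimes>\<^bsub>R\<^esub> t)"
proof -
  let ?f = "\<lambda>(a, s) (m, t). loc_frac M S (a \<odot>\<^bsub>M\<^esub> m) (s \<otimes>\<^bsub>R\<^esub> t)"
  have cong: "congruent2 (frac_rel (self_module R) S) (frac_rel M S) ?f"
  proof (rule congruent2I', clarify)
    fix a s a' s' m t m' t'
    assume "((a, s), (a', s')) \<in> frac_rel (self_module R) S" and "((m, t), (m', t')) \<in> frac_rel M S"
    then obtain u v where c: "a \<in> carrier R" "m \<in> carrier M" "a' \<in> carrier R" "m' \<in> carrier M"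
      "s \<in> S" "t \<in> S" "s' \<in> S" "t' \<in> S" "u \<in> S" "v \<in> S"
      and u: "u \<otimes> (s' \<otimes> a) = u \<otimes> (s \<otimes> a')"
      and v: "v \<odot>\<^bsub>M\<^esub> (t' \<odot>\<^bsub>M\<^esub> m) = v \<odot>\<^bsub>M\<^esub> (t \<odot>\<^bsub>M\<^esub> m')"
      by (auto simp: frac_rel_def self_module_def)
    have "(u \<otimes> v) \<odot>\<^bsub>M\<^esub> ((s' \<otimes> t') \<odot>\<^bsub>M\<^esub> (a \<odot>\<^bsub>M\<^esub> m))
        = (u \<otimes> (s' \<otimes> a)) \<odot>\<^bsub>M\<^esub> (v \<odot>\<^bsub>M\<^esub> (t' \<odot>\<^bsub>M\<^esub> m))"
      using c by (simp add: smult_assoc1 smult_lcomm)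
    also have "\<dots> = (u \<otimes> v) \<odot>\<^bsub>M\<^esub> ((s \<otimes> t) \<odot>\<^bsub>M\<^esub> (a' \<odot>\<^bsub>M\<^esub> m'))"
      unfolding u v using c by (simp add: smult_assoc1 smult_lcomm)
    finally show "loc_frac M S (a \<odot>\<^bsub>M\<^esub> m) (s \<otimes>\<^bsub>R\<^esub> t) = loc_frac M S (a' \<odot>\<^bsub>M\<^esub> m') (s' \<otimes>\<^bsub>R\<^esub> t')"
      by (rule loc_frac_eqI) (use c mult_denom in auto)
  qed
  show ?thesis
    using UN_equiv_class2[OF localisation.equiv_frac_rel[OF localisation_self_module]
        equiv_frac_rel cong, of "(a, s)" "(m, t)"] assms
    by (simp add: loc_module_def loc_frac_def self_module_def case_prod_beta')
qed

text \<open>Since \<open>s\<^sub>i \<cdot> (m\<^sub>i / s\<^sub>i) = m\<^sub>i / 1\<close>, a multiple \<open>(a m\<^sub>i) / 1\<close> of a numerator has an expansion with the single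
  coefficient \<open>(a s\<^sub>i) / 1\<close> in the family \<open>m\<^sub>j / s\<^sub>j\<close>. Comparing two such expansions gives the vanishing
  of coefficients below.\<close>

lemma finsum_loc_single:
  fixes a :: 'a and n :: nat
  assumes e: "\<And>i. i < n \<Longrightarrow> m i \<in> carrier M \<and> s i \<in> S"
    and i: "i < n" and a: "a \<in> carrier R"
  defines "c \<equiv> \<lambda>j\<in>{..<n}. ring_frac (if i = j then a \<otimes> s i else \<zero>) \<one>"
  shows "c \<in> {..<n} \<rightarrow>\<^sub>E carrier (loc_ring R S)"
    and "(\<Oplus>\<^bsub>loc_module R M S\<^esub>j\<in>{..<n}. c j \<odot>\<^bsub>loc_module R M S\<^esub> loc_frac M S (m j) (s j))
      = loc_frac M S (a \<odot>\<^bsub>M\<^esub> m i) \<one>"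
proof -
  let ?L = "loc_module R M S"
  interpret L: abelian_monoid ?L by (rule abelian_monoid_loc_module)
  show "c \<in> {..<n} \<rightarrow>\<^sub>E carrier (loc_ring R S)"
    using e i a one_denom by (auto simp: c_def)
  have "(\<Oplus>\<^bsub>?L\<^esub>j\<in>{..<n}. c j \<odot>\<^bsub>?L\<^esub> loc_frac M S (m j) (s j))
      = (\<Oplus>\<^bsub>?L\<^esub>j\<in>{..<n}. if i = j then loc_frac M S (a \<odot>\<^bsub>M\<^esub> m j) \<one> else \<zero>\<^bsub>?L\<^esub>)"
  proof (rule L.finsum_cong')
    fix j assume j: "j \<in> {..<n}"
    have "loc_frac M S ((a \<otimes> s j) \<odot>\<^bsub>M\<^esub> m j) (\<one> \<otimes> s j) = loc_frac M S (a \<odot>\<^bsub>M\<^esub> m j) \<one>"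
      by (rule loc_frac_eqI[OF _ one_denom])
        (use e j a one_denom in \<open>auto simp: smult_assoc1 smult_lcomm\<close>)
    then show "c j \<odot>\<^bsub>?L\<^esub> loc_frac M S (m j) (s j)
        = (if i = j then loc_frac M S (a \<odot>\<^bsub>M\<^esub> m j) \<one> else \<zero>\<^bsub>?L\<^esub>)"
      using e[of j] j a one_denom by (simp add: c_def loc_smult loc_frac_zero)
  qed (use e a one_denom in auto)
  also have "\<dots> = loc_frac M S (a \<odot>\<^bsub>M\<^esub> m i) \<one>"
    by (rule L.finsum_singleton) (use e i a one_denom in auto)
  finally show "(\<Oplus>\<^bsub>?L\<^esub>j\<in>{..<n}. c j \<odot>\<^bsub>?L\<^esub> loc_frac M S (m j) (s j))
      = loc_frac M S (a \<odot>\<^bsub>M\<^esub> m i) \<one>" .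
qed

text \<open>The local heart of the argument: in a basis \<open>m\<^sub>i / s\<^sub>i\<close> of the localisation, \<open>\<phi>(m\<^sub>i) m\<^sub>j = \<phi>(m\<^sub>j) m\<^sub>i\<close>
  with \<open>i \<noteq> j\<close> is one vector with two expansions, supported at \<open>j\<close> and at \<open>i\<close>. By uniqueness \<open>\<phi>(m\<^sub>i)\<close>
  vanishes in the localised ring, so \<open>\<phi>\<close> vanishes locally on a basis and hence everywhere. The
  conclusion is phrased with a denominator \<open>u\<close>, which avoids extending \<open>\<phi>\<close> to the localisation.\<close>

lemma proportional_form_loc_zero:
  assumes free: "free_of_rank (loc_ring R S) (loc_module R M S) n" and n: "n \<noteq> 1"
    and \<phi>: "\<phi> \<in> linear_maps R M (self_module R)"
    and swap: "\<And>p q. \<lbrakk>p \<in> carrier M; q \<in> carrier M\<rbrakk> \<Longrightarrow> \<phi> p \<odot>\<^bsub>M\<^esub> q = \<phi> q \<odot>\<^bsub>M\<^esub> p"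
    and p: "p \<in> carrier M"
  shows "\<exists>u\<in>S. u \<otimes> \<phi> p = \<zero>"
proof -
  let ?L = "loc_module R M S"
  interpret L: abelian_monoid ?L by (rule abelian_monoid_loc_module)
  have \<phi>c [simp]: "\<phi> x \<in> carrier R" if "x \<in> carrier M" for x
    using \<phi> that by (auto simp: linear_maps_def self_module_def)
  have \<phi>add: "\<phi> (x \<oplus>\<^bsub>M\<^esub> y) = \<phi> x \<oplus> \<phi> y" if "x \<in> carrier M" "y \<in> carrier M" for x y
    using \<phi> that by (auto simp: linear_maps_def self_module_def)
  have \<phi>smult: "\<phi> (a \<odot>\<^bsub>M\<^esub> x) = a \<otimes> \<phi> x" if "a \<in> carrier R" "x \<in> carrier M" for a x
    using \<phi> that by (auto simp: linear_maps_def self_module_def)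
  have \<phi>0: "\<phi> \<zero>\<^bsub>M\<^esub> = \<zero>"
    using \<phi>smult[of \<zero> "\<zero>\<^bsub>M\<^esub>"] by simp
  obtain e where e: "e \<in> {..<n} \<rightarrow> carrier ?L"
    and uniq: "\<And>x. x \<in> carrier ?L \<Longrightarrow> \<exists>!c. c \<in> {..<n} \<rightarrow>\<^sub>E carrier (loc_ring R S) \<and>
       x = (\<Oplus>\<^bsub>?L\<^esub>i\<in>{..<n}. c i \<odot>\<^bsub>?L\<^esub> e i)"
    using free unfolding free_of_rank_def by (elim bexE) (rule that, assumption, drule bspec, assumption+)
  have "\<forall>i\<in>{..<n}. \<exists>f. fst f \<in> carrier M \<and> snd f \<in> S \<and> e i = loc_frac M S (fst f) (snd f)"
  proof
    fix i assume "i \<in> {..<n}"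
    then have "e i \<in> carrier ?L"
      using e by blast
    then obtain a b where "a \<in> carrier M" "b \<in> S" "e i = loc_frac M S a b"
      by (rule loc_fracE)
    then show "\<exists>f. fst f \<in> carrier M \<and> snd f \<in> S \<and> e i = loc_frac M S (fst f) (snd f)"
      by (intro exI[of _ "(a, b)"]) simp
  qed
  then obtain f where f: "\<forall>i\<in>{..<n}. fst (f i) \<in> carrier M \<and> snd (f i) \<in> S
      \<and> e i = loc_frac M S (fst (f i)) (snd (f i))"
    using bchoice by meson
  define m where "m i = fst (f i)" for i
  define s where "s i = snd (f i)" for i
  have ms: "m i \<in> carrier M \<and> s i \<in> S" and e_eq: "e i = loc_frac M S (m i) (s i)" if "i < n" for i
    using f that by (auto simp: m_def s_def)
  have ec: "(\<Oplus>\<^bsub>?L\<^esub>i\<in>{..<n}. c i \<odot>\<^bsub>?L\<^esub> e i) = (\<Oplus>\<^bsub>?L\<^esub>i\<in>{..<n}. c i \<odot>\<^bsub>?L\<^esub> loc_frac M S (m i) (s i))"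
    if c: "c \<in> {..<n} \<rightarrow>\<^sub>E carrier (loc_ring R S)" for c
  proof (rule L.finsum_cong')
    fix i assume i: "i \<in> {..<n}"
    obtain a t where "a \<in> carrier R" "t \<in> S" "c i = ring_frac a t"
      using PiE_mem[OF c i] by (auto simp: carrier_loc_ring)
    then show "c i \<odot>\<^bsub>?L\<^esub> e i = c i \<odot>\<^bsub>?L\<^esub> loc_frac M S (m i) (s i)"
      using i by (simp add: e_eq)
  next
    show "(\<lambda>i. c i \<odot>\<^bsub>?L\<^esub> loc_frac M S (m i) (s i)) \<in> {..<n} \<rightarrow> carrier ?L"
    proof
      fix i assume i: "i \<in> {..<n}"
      obtain a t where "a \<in> carrier R" "t \<in> S" "c i = ring_frac a t"
        using PiE_mem[OF c i] by (auto simp: carrier_loc_ring)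
      then show "c i \<odot>\<^bsub>?L\<^esub> loc_frac M S (m i) (s i) \<in> carrier ?L"
        using i ms by (simp add: loc_smult mult_denom)
    qed
  qed simp
  have basis: "\<exists>u\<in>S. u \<otimes> \<phi> (m i) = \<zero>" if i: "i < n" for i
  proof -
    \<comment> \<open>An index other than \<open>i\<close>; it is below \<open>n\<close> because \<open>i < n\<close> and \<open>n \<noteq> 1\<close>.\<close>
    define j where "j = (if i = 0 then 1 else 0 :: nat)"
    have j: "j < n" "j \<noteq> i"
      using i n by (auto simp: j_def)
    define ci where "ci = (\<lambda>k\<in>{..<n}. ring_frac (if i = k then \<phi> (m j) \<otimes> s i else \<zero>) \<one>)"
    define cj where "cj = (\<lambda>k\<in>{..<n}. ring_frac (if j = k then \<phi> (m i) \<otimes> s j else \<zero>) \<one>)"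
    let ?x = "loc_frac M S (\<phi> (m i) \<odot>\<^bsub>M\<^esub> m j) \<one>"
    have x: "?x \<in> carrier ?L"
      using ms i j one_denom by simp
    have "ci = cj"
    proof -
      have ci: "ci \<in> {..<n} \<rightarrow>\<^sub>E carrier (loc_ring R S)"
        unfolding ci_def by (rule finsum_loc_single(1)) (use ms i j in auto)
      have "(\<Oplus>\<^bsub>?L\<^esub>k\<in>{..<n}. ci k \<odot>\<^bsub>?L\<^esub> loc_frac M S (m k) (s k))
          = loc_frac M S (\<phi> (m j) \<odot>\<^bsub>M\<^esub> m i) \<one>"
        unfolding ci_def by (rule finsum_loc_single(2)) (use ms i j in auto)
      then have sci: "?x = (\<Oplus>\<^bsub>?L\<^esub>k\<in>{..<n}. ci k \<odot>\<^bsub>?L\<^esub> e k)"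
        using ec[OF ci] swap[of "m i" "m j"] ms i j by simp
      have cj: "cj \<in> {..<n} \<rightarrow>\<^sub>E carrier (loc_ring R S)"
        unfolding cj_def by (rule finsum_loc_single(1)) (use ms i j in auto)
      have "(\<Oplus>\<^bsub>?L\<^esub>k\<in>{..<n}. cj k \<odot>\<^bsub>?L\<^esub> loc_frac M S (m k) (s k))
          = loc_frac M S (\<phi> (m i) \<odot>\<^bsub>M\<^esub> m j) \<one>"
        unfolding cj_def by (rule finsum_loc_single(2)) (use ms i j in auto)
      then have scj: "?x = (\<Oplus>\<^bsub>?L\<^esub>k\<in>{..<n}. cj k \<odot>\<^bsub>?L\<^esub> e k)"
        using ec[OF cj] by simp
      show ?thesis
        using uniq[OF x] ci sci cj scj by blast
    qed
    \<comment> \<open>Both expansions are evaluated at the index \<open>j\<close>.\<close>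
    then have "ring_frac (\<phi> (m i) \<otimes> s j) \<one> = ring_frac \<zero> \<one>"
      using j by (auto simp: ci_def cj_def fun_eq_iff dest: spec[of _ j])
    then obtain u where "u \<in> S" "u \<otimes> (\<one> \<otimes> (\<phi> (m i) \<otimes> s j)) = u \<otimes> (\<one> \<otimes> \<zero>)"
      by (rule localisation.loc_frac_eqD[OF localisation_self_module])
        (use ms i j one_denom in \<open>auto simp: self_module_def\<close>)
    then have "(u \<otimes> s j) \<otimes> \<phi> (m i) = \<zero>" "u \<otimes> s j \<in> S"
      using ms i j by (auto simp: R.m_ac mult_denom)
    then show ?thesis by blast
  qed
  \<comment> \<open>The kernel of the localised form; it contains the basis, and it is closed under sums and multiples.\<close>
  define N where "N = {loc_frac M S x t | x t. x \<in> carrier M \<and> t \<in> S \<and> (\<exists>u\<in>S. u \<otimes> \<phi> x = \<zero>)}"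
  have N_add: "x \<oplus>\<^bsub>?L\<^esub> y \<in> N" if "x \<in> N" "y \<in> N" for x y
  proof -
    from that obtain a t u b r v where *: "x = loc_frac M S a t" "a \<in> carrier M" "t \<in> S" "u \<in> S"
      "u \<otimes> \<phi> a = \<zero>" "y = loc_frac M S b r" "b \<in> carrier M" "r \<in> S" "v \<in> S" "v \<otimes> \<phi> b = \<zero>"
      by (auto simp: N_def)
    have "(u \<otimes> v) \<otimes> \<phi> (r \<odot>\<^bsub>M\<^esub> a \<oplus>\<^bsub>M\<^esub> t \<odot>\<^bsub>M\<^esub> b) = v \<otimes> r \<otimes> (u \<otimes> \<phi> a) \<oplus> u \<otimes> t \<otimes> (v \<otimes> \<phi> b)"
      using *(2-4,7-9) by (simp add: \<phi>add \<phi>smult R.r_distr R.m_ac)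
    also have "\<dots> = \<zero>"
      using * by simp
    finally have "loc_frac M S (r \<odot>\<^bsub>M\<^esub> a \<oplus>\<^bsub>M\<^esub> t \<odot>\<^bsub>M\<^esub> b) (t \<otimes> r) \<in> N"
      unfolding N_def using *(2-4,7-9) mult_denom denom_carrier smult_closed M.a_closed by blast
    then show ?thesis
      using * by (simp add: loc_add)
  qed
  have "(\<Oplus>\<^bsub>?L\<^esub>i\<in>{..<n}. f i) \<in> N" if "\<And>i. i < n \<Longrightarrow> f i \<in> N" for f
  proof -
    have NL: "N \<subseteq> carrier ?L"
      by (auto simp: N_def)
    have "(\<Oplus>\<^bsub>?L\<^esub>i\<in>{..<k}. f i) \<in> N" if "k \<le> n" for k
      using that
    proof (induction k)
      case 0
      then show ?case
        using one_denom \<phi>0 by (auto simp: N_def loc_zero intro!: exI[of _ "\<zero>\<^bsub>M\<^esub>"] exI[of _ \<one>])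
    next
      case (Suc k)
      have "(\<Oplus>\<^bsub>?L\<^esub>i\<in>{..<Suc k}. f i) = f k \<oplus>\<^bsub>?L\<^esub> (\<Oplus>\<^bsub>?L\<^esub>i\<in>{..<k}. f i)"
        unfolding lessThan_Suc
        by (rule L.finsum_insert) (use Suc.prems NL \<open>\<And>i. i < n \<Longrightarrow> f i \<in> N\<close> in auto)
      then show ?case
        using Suc N_add \<open>\<And>i. i < n \<Longrightarrow> f i \<in> N\<close> by simp
    qed
    then show ?thesis by blast
  qed
  moreover have "c i \<odot>\<^bsub>?L\<^esub> loc_frac M S (m i) (s i) \<in> N"
    if c: "c \<in> {..<n} \<rightarrow>\<^sub>E carrier (loc_ring R S)" and i: "i < n" for c i
  proof -
    obtain a t where a: "a \<in> carrier R" "t \<in> S" "c i = ring_frac a t"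
      using PiE_mem[OF c, of i] i by (auto simp: carrier_loc_ring)
    obtain u where u: "u \<in> S" "u \<otimes> \<phi> (m i) = \<zero>"
      using basis[OF i] by blast
    have "u \<otimes> \<phi> (a \<odot>\<^bsub>M\<^esub> m i) = a \<otimes> (u \<otimes> \<phi> (m i))"
      using a u(1) ms i by (simp add: \<phi>smult R.m_lcomm)
    then have "u \<otimes> \<phi> (a \<odot>\<^bsub>M\<^esub> m i) = \<zero>"
      using a u by simp
    moreover have "c i \<odot>\<^bsub>?L\<^esub> loc_frac M S (m i) (s i) = loc_frac M S (a \<odot>\<^bsub>M\<^esub> m i) (t \<otimes> s i)"
      using a ms i by (simp add: loc_smult)
    ultimately show ?thesis
      unfolding N_def using u a ms[OF i] mult_denom by blast
  qed
  ultimately have "loc_frac M S p \<one> \<in> N"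
    using uniq[of "loc_frac M S p \<one>"] p one_denom ec by (metis (no_types, lifting) loc_frac_closed)
  then obtain x t u where x: "x \<in> carrier M" "t \<in> S" "u \<in> S" "u \<otimes> \<phi> x = \<zero>"
    and "loc_frac M S p \<one> = loc_frac M S x t"
    by (auto simp: N_def)
  then obtain v where v: "v \<in> S" "v \<odot>\<^bsub>M\<^esub> (t \<odot>\<^bsub>M\<^esub> p) = v \<odot>\<^bsub>M\<^esub> (\<one> \<odot>\<^bsub>M\<^esub> x)"
    using p one_denom by (metis loc_frac_eqD)
  have "(u \<otimes> v \<otimes> t) \<otimes> \<phi> p = u \<otimes> (v \<otimes> (t \<otimes> \<phi> p))"
    using v(1) x(1-3) p by (simp add: R.m_assoc)
  also have "v \<otimes> (t \<otimes> \<phi> p) = v \<otimes> \<phi> x"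
    using arg_cong[OF v(2), of \<phi>] v(1) x p by (simp add: \<phi>smult)
  also have "u \<otimes> (v \<otimes> \<phi> x) = v \<otimes> (u \<otimes> \<phi> x)"
    using v(1) x(1-3) by (simp add: R.m_lcomm)
  also have "\<dots> = \<zero>"
    using v(1) x(4) by simp
  finally show ?thesis
    using v(1) x(2,3) mult_denom by blast
qed

end

section \<open>Vanishing of a form by localisation at primes\<close>

text \<open>By Zorn's lemma there is an ideal that is maximal among those above \<open>J\<close> that avoid \<open>\<one>\<close>.\<close>

lemma (in cring) prime_above_ideal:
  assumes J: "ideal J R" and one: "\<one> \<notin> J"
  obtains I where "primeideal I R" "J \<subseteq> I"
proof -
  define \<A> where "\<A> = {I. ideal I R \<and> J \<subseteq> I \<and> \<one> \<notin> I}"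
  have "\<exists>I\<in>\<A>. \<forall>X\<in>\<A>. I \<subseteq> X \<longrightarrow> X = I"
  proof (rule subset_Zorn_nonempty)
    show "\<A> \<noteq> {}"
      using J one by (auto simp: \<A>_def)
    fix \<C> assume ne: "\<C> \<noteq> {}" and ch: "subset.chain \<A> \<C>"
    have id: "ideal X R" "J \<subseteq> X" "\<one> \<notin> X" if "X \<in> \<C>" for X
      using ch that by (auto simp: subset.chain_def \<A>_def)
    have "ideal (\<Union>\<C>) R"
    proof (rule idealI[OF ring_axioms])
      show "subgroup (\<Union>\<C>) (add_monoid R)"
      proof (rule add.subgroupI)
        show "\<Union>\<C> \<subseteq> carrier R"
          using id ideal.Icarr by fast
        show "\<Union>\<C> \<noteq> {}"
          using ne id(1) additive_subgroup.zero_closed ideal.axioms(1) by fast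
        show "\<ominus> a \<in> \<Union>\<C>" if "a \<in> \<Union>\<C>" for a
          using that id(1) additive_subgroup.a_inv_closed ideal.axioms(1) by fast
        show "a \<oplus> b \<in> \<Union>\<C>" if ab: "a \<in> \<Union>\<C>" "b \<in> \<Union>\<C>" for a b
        proof -
          obtain X Y where XY: "X \<in> \<C>" "Y \<in> \<C>" "a \<in> X" "b \<in> Y"
            using ab by blast
          then have "X \<subseteq> Y \<or> Y \<subseteq> X"
            using ch by (auto simp: subset.chain_def)
          then obtain Z where "Z \<in> \<C>" "a \<in> Z" "b \<in> Z"
            using XY by blast
          then show ?thesis
            using id(1) additive_subgroup.a_closed ideal.axioms(1) by (metis UnionI)
        qed
      qed
    qed (use id(1) ideal.I_l_closed ideal.I_r_closed in \<open>fast+\<close>)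
    moreover have "J \<subseteq> \<Union>\<C>"
      using ne id(2) by blast
    ultimately show "\<Union>\<C> \<in> \<A>"
      using id(3) by (auto simp: \<A>_def)
  qed
  then obtain I where I: "ideal I R" "J \<subseteq> I" "\<one> \<notin> I" and max: "\<And>X. X \<in> \<A> \<Longrightarrow> I \<subseteq> X \<Longrightarrow> X = I"
    by (auto simp: \<A>_def)
  have "maximalideal I R"
  proof (rule maximalidealI)
    show "carrier R \<noteq> I"
      using I(3) by auto
    show "X = I \<or> X = carrier R" if "ideal X R" "I \<subseteq> X" for X
      using max[of X] that I ideal.one_imp_carrier by (auto simp: \<A>_def)
  qed (rule I(1))
  then show ?thesis
    using that I(2) maximalideal_prime by blast
qed

lemma (in cring) ideal_annihilator:
  assumes a: "a \<in> carrier R"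
  shows "ideal {b \<in> carrier R. b \<otimes> a = \<zero>} R"
proof (rule idealI[OF ring_axioms])
  show "subgroup {b \<in> carrier R. b \<otimes> a = \<zero>} (add_monoid R)"
    by (rule add.subgroupI) (use a in \<open>auto simp: l_minus l_distr intro: exI[of _ \<zero>]\<close>)
qed (use a in \<open>auto simp: m_assoc m_lcomm\<close>,
     metis m_assoc m_comm r_null)

lemma (in module) localisation_at_prime:
  assumes "primeideal I R"
  shows "localisation R M (carrier R - I)"
proof -
  interpret I: primeideal I R by fact
  show ?thesis
    by unfold_locales (use I.I_notcarr I.one_imp_carrier I.I_prime in auto)
qed

text \<open>An element of a ring is zero as soon as it is killed outside every prime ideal, because its
  annihilator would otherwise lie in a prime ideal.\<close>

proposition (in module) proportional_form_zero:
  assumes rank: "has_rank R M n" and n: "n \<noteq> 1"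
    and \<phi>: "\<phi> \<in> linear_maps R M (self_module R)"
    and swap: "\<And>p q. \<lbrakk>p \<in> carrier M; q \<in> carrier M\<rbrakk> \<Longrightarrow> \<phi> p \<odot>\<^bsub>M\<^esub> q = \<phi> q \<odot>\<^bsub>M\<^esub> p"
    and p: "p \<in> carrier M"
  shows "\<phi> p = \<zero>"
proof (rule ccontr)
  assume nz: "\<phi> p \<noteq> \<zero>"
  have \<phi>p: "\<phi> p \<in> carrier R"
    using \<phi> p by (auto simp: linear_maps_def self_module_def)
  obtain I where I: "primeideal I R" "{b \<in> carrier R. b \<otimes> \<phi> p = \<zero>} \<subseteq> I"
    using R.prime_above_ideal[OF R.ideal_annihilator[OF \<phi>p]] nz \<phi>p by auto
  interpret localisation R M "carrier R - I"
    by (rule localisation_at_prime[OF I(1)])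
  have "\<exists>u\<in>carrier R - I. u \<otimes> \<phi> p = \<zero>"
    using proportional_form_loc_zero[OF _ n \<phi> swap p] rank I(1) by (simp add: has_rank_def)
  then show False
    using I(2) by auto
qed


section \<open>Modules of maps\<close>

lemma (in algebra) module_restrict_scalars:
  assumes "module M N"
  shows "module R (restrict_scalars M N)"
proof -
  interpret N: module M N by fact
  show ?thesis
  proof (rule moduleI)
    show "abelian_group (restrict_scalars M N)"
      by (rule abelian_groupI)
        (auto simp: restrict_scalars_def N.M.a_ac intro: N.M.l_neg bexI[of _ "\<ominus>\<^bsub>N\<^esub> _"])
    show "(a \<otimes> b) \<odot>\<^bsub>restrict_scalars M N\<^esub> x
        = a \<odot>\<^bsub>restrict_scalars M N\<^esub> (b \<odot>\<^bsub>restrict_scalars M N\<^esub> x)"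
      if "a \<in> carrier R" "b \<in> carrier R" "x \<in> carrier (restrict_scalars M N)" for a b x
    proof -
      have "(a \<otimes> b) \<odot>\<^bsub>M\<^esub> \<one>\<^bsub>M\<^esub> = (a \<odot>\<^bsub>M\<^esub> \<one>\<^bsub>M\<^esub>) \<otimes>\<^bsub>M\<^esub> (b \<odot>\<^bsub>M\<^esub> \<one>\<^bsub>M\<^esub>)"
        using that by (simp add: smult_assoc1 smult_assoc2)
      then show ?thesis
        using that by (simp add: restrict_scalars_def N.smult_assoc1)
    qed
  qed (auto simp: restrict_scalars_def R.is_cring smult_l_distr N.smult_l_distr N.smult_r_distr)
qed

lemma linear_maps_zero:
  assumes "module R M" "module R N" "f \<in> linear_maps R M N"
  shows "f \<zero>\<^bsub>M\<^esub> = \<zero>\<^bsub>N\<^esub>"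
proof -
  interpret M: module R M by fact
  interpret N: module R N by fact
  have "f (\<zero>\<^bsub>R\<^esub> \<odot>\<^bsub>M\<^esub> \<zero>\<^bsub>M\<^esub>) = \<zero>\<^bsub>R\<^esub> \<odot>\<^bsub>N\<^esub> f \<zero>\<^bsub>M\<^esub>" "f \<zero>\<^bsub>M\<^esub> \<in> carrier N"
    using assms(3) by (auto simp: linear_maps_def simp del: M.smult_r_null M.smult_l_null)
  then show ?thesis by simp
qed

text \<open>Negatives are multiples by \<open>\<ominus> \<one>\<close>, so closure under them follows from closure under scalars.\<close>

lemma (in module) module_pointwise_module:
  assumes F: "F \<subseteq> S \<rightarrow>\<^sub>E carrier M" and zero: "(\<lambda>x\<in>S. \<zero>\<^bsub>M\<^esub>) \<in> F"
    and add: "\<And>f g. \<lbrakk>f \<in> F; g \<in> F\<rbrakk> \<Longrightarrow> (\<lambda>x\<in>S. f x \<oplus>\<^bsub>M\<^esub> g x) \<in> F"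
    and smult: "\<And>r f. \<lbrakk>r \<in> carrier R; f \<in> F\<rbrakk> \<Longrightarrow> (\<lambda>x\<in>S. r \<odot>\<^bsub>M\<^esub> f x) \<in> F"
  shows "module R (pointwise_module S M F)"
proof -
  have c [simp]: "f x \<in> carrier M" if "f \<in> F" "x \<in> S" for f x
    using F that by blast
  have ext: "f x = undefined" if "f \<in> F" "x \<notin> S" for f x
    using F that by blast
  show ?thesis
  proof (rule moduleI)
    show "abelian_group (pointwise_module S M F)"
    proof (rule abelian_groupI)
      fix f assume f: "f \<in> carrier (pointwise_module S M F)"
      then have "(\<lambda>x\<in>S. (\<ominus> \<one>) \<odot>\<^bsub>M\<^esub> f x) \<in> F"
        by (intro smult) (auto simp: pointwise_module_def)
      moreover have "(\<ominus> \<one>) \<odot>\<^bsub>M\<^esub> f x \<oplus>\<^bsub>M\<^esub> f x = \<zero>\<^bsub>M\<^esub>" if "x \<in> S" for x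
        using f that by (simp add: pointwise_module_def smult_l_minus M.l_neg)
      ultimately show "\<exists>g\<in>carrier (pointwise_module S M F).
          g \<oplus>\<^bsub>pointwise_module S M F\<^esub> f = \<zero>\<^bsub>pointwise_module S M F\<^esub>"
        by (intro bexI[of _ "\<lambda>x\<in>S. (\<ominus> \<one>) \<odot>\<^bsub>M\<^esub> f x"])
          (auto simp: pointwise_module_def fun_eq_iff restrict_def)
      show "\<zero>\<^bsub>pointwise_module S M F\<^esub> \<oplus>\<^bsub>pointwise_module S M F\<^esub> f = f"
        using f ext[of f] by (auto simp: pointwise_module_def fun_eq_iff restrict_def)
    qed (auto simp: pointwise_module_def zero[unfolded restrict_def] add[unfolded restrict_def]
        M.a_ac fun_eq_iff restrict_def)
    fix f assume f: "f \<in> carrier (pointwise_module S M F)"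
    then show "\<one> \<odot>\<^bsub>pointwise_module S M F\<^esub> f = f"
      using ext[of f] by (auto simp: pointwise_module_def fun_eq_iff restrict_def)
  qed (auto simp: pointwise_module_def smult[unfolded restrict_def] R.is_cring fun_eq_iff restrict_def
      smult_l_distr smult_r_distr smult_assoc1)
qed

section \<open>Diolic algebras\<close>

locale diolic_algebra = A: algebra K A + P: module A P
  for K :: "('k, 'm) ring_scheme" and A :: "('k, 'a, 'x) module_scheme"
    and P :: "('a, 'p, 'y) module_scheme"
begin

lemma diolic_over_simps:
  "carrier (diolic_over A P) = carrier A \<times> carrier P"
  "\<zero>\<^bsub>diolic_over A P\<^esub> = (\<zero>\<^bsub>A\<^esub>, \<zero>\<^bsub>P\<^esub>)"
  "(a, p) \<oplus>\<^bsub>diolic_over A P\<^esub> (b, q) = (a \<oplus>\<^bsub>A\<^esub> b, p \<oplus>\<^bsub>P\<^esub> q)"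
  "c \<odot>\<^bsub>diolic_over A P\<^esub> (a, p) = (c \<otimes>\<^bsub>A\<^esub> a, c \<odot>\<^bsub>P\<^esub> p)"
  by (auto simp: diolic_over_def)

lemma diolic_simps:
  "carrier (diolic A P) = carrier A \<times> carrier P"
  "\<zero>\<^bsub>diolic A P\<^esub> = (\<zero>\<^bsub>A\<^esub>, \<zero>\<^bsub>P\<^esub>)"
  "(a, p) \<oplus>\<^bsub>diolic A P\<^esub> (b, q) = (a \<oplus>\<^bsub>A\<^esub> b, p \<oplus>\<^bsub>P\<^esub> q)"
  "(a, p) \<otimes>\<^bsub>diolic A P\<^esub> (b, q) = (a \<otimes>\<^bsub>A\<^esub> b, a \<odot>\<^bsub>P\<^esub> q \<oplus>\<^bsub>P\<^esub> b \<odot>\<^bsub>P\<^esub> p)"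
  "k \<odot>\<^bsub>diolic A P\<^esub> (a, p) = ((k \<odot>\<^bsub>A\<^esub> \<one>\<^bsub>A\<^esub>) \<otimes>\<^bsub>A\<^esub> a, (k \<odot>\<^bsub>A\<^esub> \<one>\<^bsub>A\<^esub>) \<odot>\<^bsub>P\<^esub> p)"
  by (auto simp: diolic_def restrict_scalars_def diolic_over_def)

lemma module_diolic_over: "module A (diolic_over A P)"
proof (rule moduleI)
  show "abelian_group (diolic_over A P)"
  proof (rule abelian_groupI)
    fix x assume "x \<in> carrier (diolic_over A P)"
    then show "\<exists>y\<in>carrier (diolic_over A P). y \<oplus>\<^bsub>diolic_over A P\<^esub> x = \<zero>\<^bsub>diolic_over A P\<^esub>"
      by (intro bexI[of _ "(\<ominus>\<^bsub>A\<^esub> fst x, \<ominus>\<^bsub>P\<^esub> snd x)"])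
        (auto simp: diolic_over_simps A.l_neg P.M.l_neg)
  qed (auto simp: diolic_over_simps A.M.a_ac P.M.a_ac)
qed (auto simp: diolic_over_simps A.M_cring A.l_distr A.r_distr A.m_assoc
    P.smult_l_distr P.smult_r_distr P.smult_assoc1)

lemma module_diolic: "module K (diolic A P)"
  unfolding diolic_def by (rule A.module_restrict_scalars[OF module_diolic_over])

lemma diolic_minus:
  assumes "a \<in> carrier A" "p \<in> carrier P"
  shows "\<ominus>\<^bsub>diolic A P\<^esub> (a, p) = (\<ominus>\<^bsub>A\<^esub> a, \<ominus>\<^bsub>P\<^esub> p)"
proof -
  interpret B: module K "diolic A P" by (rule module_diolic)
  show ?thesis
    by (rule B.M.minus_equality)
      (use assms in \<open>auto simp: diolic_simps A.l_neg P.M.l_neg\<close>)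
qed

lemma koszul_zero: "koszul (diolic A P) n (\<zero>\<^bsub>A\<^esub>, \<zero>\<^bsub>P\<^esub>) = (\<zero>\<^bsub>A\<^esub>, \<zero>\<^bsub>P\<^esub>)"
  by (simp add: koszul_def diolic_minus)

lemma self_module_simps:
  "carrier (restrict_scalars A (self_module A)) = carrier A"
  "add (restrict_scalars A (self_module A)) = add A"
  "smult (restrict_scalars A (self_module A)) = (\<lambda>k x. (k \<odot>\<^bsub>A\<^esub> \<one>\<^bsub>A\<^esub>) \<otimes>\<^bsub>A\<^esub> x)"
  "smult (self_module A) = mult A" "add (self_module A) = add A"
  by (auto simp: restrict_scalars_def self_module_def)

lemma smult_one_mult:
  "\<lbrakk>k \<in> carrier K; a \<in> carrier A\<rbrakk> \<Longrightarrow> (k \<odot>\<^bsub>A\<^esub> \<one>\<^bsub>A\<^esub>) \<otimes>\<^bsub>A\<^esub> a = k \<odot>\<^bsub>A\<^esub> a"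
  by (simp add: A.smult_assoc2)

lemma derivation_zero:
  assumes "module A Q" "d \<in> derivations K A Q"
  shows "d \<zero>\<^bsub>A\<^esub> = \<zero>\<^bsub>Q\<^esub>"
  using linear_maps_zero[OF A.module A.module_restrict_scalars[OF assms(1)], of d] assms(2)
  by (auto simp: derivations_def restrict_scalars_def)

lemma module_derivation_module:
  assumes "module A Q"
  shows "module A (derivation_module K A Q)"
proof -
  interpret Q: module A Q by fact
  show ?thesis
    unfolding derivation_module_def
  proof (rule Q.module_pointwise_module)
    show "derivations K A Q \<subseteq> carrier A \<rightarrow>\<^sub>E carrier Q"
      by (auto simp: derivations_def linear_maps_def restrict_scalars_def)
    show "(\<lambda>x\<in>carrier A. \<zero>\<^bsub>Q\<^esub>) \<in> derivations K A Q"
      by (auto simp: derivations_def linear_maps_def restrict_scalars_def)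
  next
    fix d d' assume d: "d \<in> derivations K A Q" and d': "d' \<in> derivations K A Q"
    then have [simp]: "d a \<in> carrier Q" "d' a \<in> carrier Q" if "a \<in> carrier A" for a
      using that by (auto simp: derivations_def linear_maps_def restrict_scalars_def)
    show "(\<lambda>x\<in>carrier A. d x \<oplus>\<^bsub>Q\<^esub> d' x) \<in> derivations K A Q"
      using d d' by (auto simp: derivations_def linear_maps_def restrict_scalars_def
          Q.smult_r_distr Q.M.a_ac)
  next
    fix c d assume c: "c \<in> carrier A" and d: "d \<in> derivations K A Q"
    then have [simp]: "d a \<in> carrier Q" if "a \<in> carrier A" for a
      using that by (auto simp: derivations_def linear_maps_def restrict_scalars_def)
    show "(\<lambda>x\<in>carrier A. c \<odot>\<^bsub>Q\<^esub> d x) \<in> derivations K A Q"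
      using c d by (auto simp: derivations_def linear_maps_def restrict_scalars_def
          Q.smult_r_distr Q.smult_lcomm)
  qed
qed

context
  fixes X g
  assumes X: "X \<in> diolic_derivations K A P g"
begin

lemma diolic_derivation_linear: "X \<in> linear_maps K (diolic A P) (diolic A P)"
  using X by (auto simp: diolic_derivations_def graded_derivations_def)

lemma diolic_derivation_grading: "x \<in> diolic_component A P i \<Longrightarrow> X x \<in> diolic_component A P (i + g)"
  using X by (auto simp: diolic_derivations_def graded_derivations_def)

lemma diolic_derivation_Leibniz:
  "\<lbrakk>x \<in> diolic_component A P i; y \<in> diolic_component A P j\<rbrakk> \<Longrightarrow>
   X (x \<otimes>\<^bsub>diolic A P\<^esub> y) = X x \<otimes>\<^bsub>diolic A P\<^esub> y
     \<oplus>\<^bsub>diolic A P\<^esub> koszul (diolic A P) (g * i) (x \<otimes>\<^bsub>diolic A P\<^esub> X y)"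
  using X by (auto simp: diolic_derivations_def graded_derivations_def)

lemma diolic_derivation_add:
  "\<lbrakk>x \<in> carrier A \<times> carrier P; y \<in> carrier A \<times> carrier P\<rbrakk> \<Longrightarrow>
   X (x \<oplus>\<^bsub>diolic A P\<^esub> y) = X x \<oplus>\<^bsub>diolic A P\<^esub> X y"
  using diolic_derivation_linear by (auto simp: linear_maps_def diolic_simps)

lemma diolic_derivation_smult:
  "\<lbrakk>x \<in> carrier A \<times> carrier P; k \<in> carrier K\<rbrakk> \<Longrightarrow>
   X (k \<odot>\<^bsub>diolic A P\<^esub> x) = k \<odot>\<^bsub>diolic A P\<^esub> X x"
  using diolic_derivation_linear by (auto simp: linear_maps_def diolic_simps)

lemma diolic_derivation_split:
  assumes "a \<in> carrier A" "p \<in> carrier P"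
  shows "X (a, p) = X (a, \<zero>\<^bsub>P\<^esub>) \<oplus>\<^bsub>diolic A P\<^esub> X (\<zero>\<^bsub>A\<^esub>, p)"
  using diolic_derivation_add[of "(a, \<zero>\<^bsub>P\<^esub>)" "(\<zero>\<^bsub>A\<^esub>, p)"] assms by (simp add: diolic_simps)

lemma diolic_derivation_undefined: "x \<notin> carrier A \<times> carrier P \<Longrightarrow> X x = undefined"
  using diolic_derivation_linear by (cases x) (auto simp: linear_maps_def diolic_simps PiE_def extensional_def)

end

lemma zero_diolic_derivation:
  "(\<lambda>x\<in>carrier (diolic A P). \<zero>\<^bsub>diolic A P\<^esub>) \<in> diolic_derivations K A P g"
  by (auto simp: diolic_derivations_def graded_derivations_def linear_maps_def diolic_simps
      diolic_component_def koszul_zero split: if_splits)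

subsection \<open>Degree zero\<close>

abbreviation diagonal_map where
  "diagonal_map d D \<equiv> \<lambda>x\<in>carrier A \<times> carrier P. (d (fst x), D (snd x))"

definition derivation_pairs where
  "derivation_pairs = {(d, D). d \<in> derivations K A (self_module A) \<and>
     D \<in> linear_maps K (restrict_scalars A P) (restrict_scalars A P) \<and>
     (\<forall>a\<in>carrier A. \<forall>p\<in>carrier P. D (a \<odot>\<^bsub>P\<^esub> p) = d a \<odot>\<^bsub>P\<^esub> p \<oplus>\<^bsub>P\<^esub> a \<odot>\<^bsub>P\<^esub> D p)}"

text \<open>In degree \<open>0\<close> all Koszul signs are trivial, and the Leibniz rule holds for arbitrary elements, not
  just for homogeneous ones.\<close>

lemma diagonal_map_derivation:
  assumes dD: "(d, D) \<in> derivation_pairs"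
  shows "diagonal_map d D \<in> diolic_derivations K A P 0"
proof -
  have d: "d \<in> derivations K A (self_module A)"
    and D: "D \<in> linear_maps K (restrict_scalars A P) (restrict_scalars A P)"
    and dD: "\<And>a p. \<lbrakk>a \<in> carrier A; p \<in> carrier P\<rbrakk> \<Longrightarrow> D (a \<odot>\<^bsub>P\<^esub> p) = d a \<odot>\<^bsub>P\<^esub> p \<oplus>\<^bsub>P\<^esub> a \<odot>\<^bsub>P\<^esub> D p"
    using dD by (auto simp: derivation_pairs_def)
  have d_lin: "d (a \<oplus>\<^bsub>A\<^esub> b) = d a \<oplus>\<^bsub>A\<^esub> d b" "d (a \<otimes>\<^bsub>A\<^esub> b) = b \<otimes>\<^bsub>A\<^esub> d a \<oplus>\<^bsub>A\<^esub> a \<otimes>\<^bsub>A\<^esub> d b"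
    if "a \<in> carrier A" "b \<in> carrier A" for a b
    using d that by (auto simp: derivations_def linear_maps_def self_module_simps)
  have d_c [simp]: "d a \<in> carrier A" if "a \<in> carrier A" for a
    using d that by (auto simp: derivations_def linear_maps_def self_module_simps)
  have d_smult: "d (k \<odot>\<^bsub>A\<^esub> a) = k \<odot>\<^bsub>A\<^esub> d a" if "a \<in> carrier A" "k \<in> carrier K" for a k
    using d that by (auto simp: derivations_def linear_maps_def self_module_simps smult_one_mult)
  have D_c [simp]: "D p \<in> carrier P" if "p \<in> carrier P" for p
    using D that by (auto simp: linear_maps_def restrict_scalars_def)
  have D_lin: "D (p \<oplus>\<^bsub>P\<^esub> q) = D p \<oplus>\<^bsub>P\<^esub> D q" if "p \<in> carrier P" "q \<in> carrier P" for p q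
    using D that by (auto simp: linear_maps_def restrict_scalars_def)
  have D_smult: "D ((k \<odot>\<^bsub>A\<^esub> \<one>\<^bsub>A\<^esub>) \<odot>\<^bsub>P\<^esub> p) = (k \<odot>\<^bsub>A\<^esub> \<one>\<^bsub>A\<^esub>) \<odot>\<^bsub>P\<^esub> D p"
    if "p \<in> carrier P" "k \<in> carrier K" for p k
    using D that by (auto simp: linear_maps_def restrict_scalars_def)
  have d0: "d \<zero>\<^bsub>A\<^esub> = \<zero>\<^bsub>A\<^esub>"
    using derivation_zero[OF A.module_self_module d] by (simp add: self_module_def)
  have D0: "D \<zero>\<^bsub>P\<^esub> = \<zero>\<^bsub>P\<^esub>"
    using linear_maps_zero[OF A.module_restrict_scalars A.module_restrict_scalars D]
      P.module_axioms by (simp add: restrict_scalars_def)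
  have Leibniz: "diagonal_map d D (x \<otimes>\<^bsub>diolic A P\<^esub> y) = diagonal_map d D x \<otimes>\<^bsub>diolic A P\<^esub> y
      \<oplus>\<^bsub>diolic A P\<^esub> x \<otimes>\<^bsub>diolic A P\<^esub> diagonal_map d D y"
    if "x \<in> carrier A \<times> carrier P" "y \<in> carrier A \<times> carrier P" for x y
    using that by (auto simp: diolic_simps d_lin D_lin dD A.m_comm A.a_comm P.M.a_ac)
  have component: "diolic_component A P i \<subseteq> carrier A \<times> carrier P" for i
    by (auto simp: diolic_component_def)
  show ?thesis
    unfolding diolic_derivations_def graded_derivations_def
  proof (intro CollectI conjI allI ballI)
    show "diagonal_map d D \<in> linear_maps K (diolic A P) (diolic A P)"
      by (auto simp: linear_maps_def diolic_simps d_lin D_lin d_smult D_smult smult_one_mult)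
    show "diagonal_map d D ` diolic_component A P i \<subseteq> diolic_component A P (i + 0)" for i
      by (auto simp: diolic_component_def d0 D0)
  next
    fix i j x y assume "x \<in> diolic_component A P i" "y \<in> diolic_component A P j"
    then have "x \<in> carrier A \<times> carrier P" "y \<in> carrier A \<times> carrier P"
      using component by blast+
    from Leibniz[OF this]
    show "diagonal_map d D (x \<otimes>\<^bsub>diolic A P\<^esub> y) = diagonal_map d D x \<otimes>\<^bsub>diolic A P\<^esub> y
      \<oplus>\<^bsub>diolic A P\<^esub> koszul (diolic A P) (0 * i) (x \<otimes>\<^bsub>diolic A P\<^esub> diagonal_map d D y)"
      by (simp add: koszul_def del: restrict_apply)
  qed
qed

lemma degree_zero_derivation:
  assumes X: "X \<in> diolic_derivations K A P 0"
  shows "(restr_AA A P X, restr_PP A P X) \<in> derivation_pairs"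
    and "X = diagonal_map (restr_AA A P X) (restr_PP A P X)"
proof -
  define d where "d = restr_AA A P X"
  define D where "D = restr_PP A P X"
  note L = diolic_derivation_Leibniz[OF X, unfolded koszul_def]
  note lin = diolic_derivation_add[OF X]
  note lins = diolic_derivation_smult[OF X]
  have XA: "X (a, \<zero>\<^bsub>P\<^esub>) = (d a, \<zero>\<^bsub>P\<^esub>)" and dc [simp]: "d a \<in> carrier A" if "a \<in> carrier A" for a
    using diolic_derivation_grading[OF X, of "(a, \<zero>\<^bsub>P\<^esub>)" 0] that
    by (auto simp: diolic_component_def d_def restr_AA_def)
  have XP: "X (\<zero>\<^bsub>A\<^esub>, p) = (\<zero>\<^bsub>A\<^esub>, D p)" and Dc [simp]: "D p \<in> carrier P" if "p \<in> carrier P" for p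
    using diolic_derivation_grading[OF X, of "(\<zero>\<^bsub>A\<^esub>, p)" 1] that
    by (auto simp: diolic_component_def D_def restr_PP_def)
  have d: "d \<in> derivations K A (self_module A)"
    unfolding derivations_def linear_maps_def
  proof (intro CollectI conjI ballI)
    show "d \<in> carrier A \<rightarrow>\<^sub>E carrier (restrict_scalars A (self_module A))"
      by (auto simp: self_module_simps) (auto simp: d_def restr_AA_def)
    fix a b assume ab: "a \<in> carrier A" "b \<in> carrier A"
    show "d (a \<oplus>\<^bsub>A\<^esub> b) = d a \<oplus>\<^bsub>restrict_scalars A (self_module A)\<^esub> d b"
      using lin[of "(a, \<zero>\<^bsub>P\<^esub>)" "(b, \<zero>\<^bsub>P\<^esub>)"] ab by (simp add: XA diolic_simps self_module_simps)
    show "d (a \<otimes>\<^bsub>A\<^esub> b) = b \<odot>\<^bsub>self_module A\<^esub> d a \<oplus>\<^bsub>self_module A\<^esub> a \<odot>\<^bsub>self_module A\<^esub> d b"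
      using L[of "(a, \<zero>\<^bsub>P\<^esub>)" 0 "(b, \<zero>\<^bsub>P\<^esub>)" 0] ab
      by (simp add: XA diolic_simps self_module_simps diolic_component_def A.m_comm)
  next
    fix k a assume "k \<in> carrier K" "a \<in> carrier A"
    then show "d (k \<odot>\<^bsub>A\<^esub> a) = k \<odot>\<^bsub>restrict_scalars A (self_module A)\<^esub> d a"
      using lins[of "(a, \<zero>\<^bsub>P\<^esub>)" k] by (simp add: XA diolic_simps self_module_simps smult_one_mult)
  qed
  have D: "D \<in> linear_maps K (restrict_scalars A P) (restrict_scalars A P)"
    unfolding linear_maps_def
  proof (intro CollectI conjI ballI)
    show "D \<in> carrier (restrict_scalars A P) \<rightarrow>\<^sub>E carrier (restrict_scalars A P)"
      by (auto simp: restrict_scalars_def) (auto simp: D_def restr_PP_def)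
    fix p assume p: "p \<in> carrier (restrict_scalars A P)"
    show "D (p \<oplus>\<^bsub>restrict_scalars A P\<^esub> q) = D p \<oplus>\<^bsub>restrict_scalars A P\<^esub> D q"
      if "q \<in> carrier (restrict_scalars A P)" for q
      using lin[of "(\<zero>\<^bsub>A\<^esub>, p)" "(\<zero>\<^bsub>A\<^esub>, q)"] p that by (simp add: XP diolic_simps restrict_scalars_def)
    show "D (k \<odot>\<^bsub>restrict_scalars A P\<^esub> p) = k \<odot>\<^bsub>restrict_scalars A P\<^esub> D p"
      if "k \<in> carrier K" for k
      using lins[of "(\<zero>\<^bsub>A\<^esub>, p)" k] p that by (simp add: XP diolic_simps restrict_scalars_def)
  qed
  have dD: "D (a \<odot>\<^bsub>P\<^esub> p) = d a \<odot>\<^bsub>P\<^esub> p \<oplus>\<^bsub>P\<^esub> a \<odot>\<^bsub>P\<^esub> D p" if "a \<in> carrier A" "p \<in> carrier P" for a p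
    using L[of "(a, \<zero>\<^bsub>P\<^esub>)" 0 "(\<zero>\<^bsub>A\<^esub>, p)" 1] that
    by (simp add: XA XP diolic_simps diolic_component_def)
  show "(restr_AA A P X, restr_PP A P X) \<in> derivation_pairs"
    using d D dD by (simp add: derivation_pairs_def flip: d_def D_def)
  have "X x = diagonal_map d D x" for x
  proof (cases "x \<in> carrier A \<times> carrier P")
    case True
    then show ?thesis
      using diolic_derivation_split[OF X] by (auto simp: XA XP diolic_simps)
  next
    case False
    then show ?thesis
      using diolic_derivation_undefined[OF X] by auto
  qed
  then show "X = diagonal_map (restr_AA A P X) (restr_PP A P X)"
    by (auto simp flip: d_def D_def)
qed

proposition degree_zero_derivations:
  "bij_betw (\<lambda>X. (restr_AA A P X, restr_PP A P X)) (diolic_derivations K A P 0) derivation_pairs"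
proof (rule bij_betw_byWitness[where f' = "\<lambda>(d, D). diagonal_map d D"])
  show "\<forall>X\<in>diolic_derivations K A P 0.
      (case (restr_AA A P X, restr_PP A P X) of (d, D) \<Rightarrow> diagonal_map d D) = X"
    using degree_zero_derivation(2) by auto
  have "restr_AA A P (diagonal_map d D) = d" "restr_PP A P (diagonal_map d D) = D"
    if "(d, D) \<in> derivation_pairs" for d D
    using that
    by (auto simp: derivation_pairs_def derivations_def linear_maps_def restr_AA_def restr_PP_def
        self_module_simps restrict_scalars_def fun_eq_iff restrict_def PiE_def extensional_def)
  then show "\<forall>dD\<in>derivation_pairs. (restr_AA A P (case dD of (d, D) \<Rightarrow> diagonal_map d D),
      restr_PP A P (case dD of (d, D) \<Rightarrow> diagonal_map d D)) = dD"
    by auto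
qed (use degree_zero_derivation(1) diagonal_map_derivation in auto)

subsection \<open>Degree one\<close>

abbreviation shift_map where
  "shift_map d \<equiv> \<lambda>x\<in>carrier A \<times> carrier P. (\<zero>\<^bsub>A\<^esub>, d (fst x))"

text \<open>The Koszul sign is nontrivial only for a left factor in \<open>P\<close>; there all terms of the Leibniz rule
  vanish, because \<open>shift_map d\<close> kills \<open>P\<close> and takes values in \<open>P\<close>.\<close>

lemma shift_map_derivation:
  assumes d: "d \<in> derivations K A P"
  shows "shift_map d \<in> diolic_derivations K A P 1"
proof -
  have d_lin: "d (a \<oplus>\<^bsub>A\<^esub> b) = d a \<oplus>\<^bsub>P\<^esub> d b" "d (a \<otimes>\<^bsub>A\<^esub> b) = b \<odot>\<^bsub>P\<^esub> d a \<oplus>\<^bsub>P\<^esub> a \<odot>\<^bsub>P\<^esub> d b"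
    if "a \<in> carrier A" "b \<in> carrier A" for a b
    using d that by (auto simp: derivations_def linear_maps_def restrict_scalars_def)
  have d_c [simp]: "d a \<in> carrier P" if "a \<in> carrier A" for a
    using d that by (auto simp: derivations_def linear_maps_def restrict_scalars_def)
  have d_smult: "d (k \<odot>\<^bsub>A\<^esub> a) = (k \<odot>\<^bsub>A\<^esub> \<one>\<^bsub>A\<^esub>) \<odot>\<^bsub>P\<^esub> d a" if "a \<in> carrier A" "k \<in> carrier K" for a k
    using d that by (auto simp: derivations_def linear_maps_def restrict_scalars_def)
  have d0: "d \<zero>\<^bsub>A\<^esub> = \<zero>\<^bsub>P\<^esub>"
    by (rule derivation_zero[OF P.module_axioms d])
  show ?thesis
    unfolding diolic_derivations_def graded_derivations_def
  proof (intro CollectI conjI allI ballI)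
    show "shift_map d \<in> linear_maps K (diolic A P) (diolic A P)"
      by (auto simp: linear_maps_def diolic_simps d_lin d_smult smult_one_mult)
    show "shift_map d ` diolic_component A P i \<subseteq> diolic_component A P (i + 1)" for i
      by (auto simp: diolic_component_def d0)
  next
    fix i j x y assume xy: "x \<in> diolic_component A P i" "y \<in> diolic_component A P j"
    have y: "y \<in> carrier A \<times> carrier P"
      using xy(2) by (auto simp: diolic_component_def split: if_splits)
    show "shift_map d (x \<otimes>\<^bsub>diolic A P\<^esub> y) = shift_map d x \<otimes>\<^bsub>diolic A P\<^esub> y
      \<oplus>\<^bsub>diolic A P\<^esub> koszul (diolic A P) (1 * i) (x \<otimes>\<^bsub>diolic A P\<^esub> shift_map d y)"
    proof (cases "i = 0")
      case True
      then show ?thesis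
        using xy(1) y by (auto simp: diolic_component_def koszul_def diolic_simps d_lin)
    next
      case False
      then obtain p where "x = (\<zero>\<^bsub>A\<^esub>, p)" "p \<in> carrier P"
        using xy(1) by (auto simp: diolic_component_def split: if_splits)
      then show ?thesis
        using y by (auto simp: diolic_simps koszul_zero d0)
    qed
  qed
qed

lemma degree_one_derivation:
  assumes X: "X \<in> diolic_derivations K A P 1"
  shows "restr_AP A P X \<in> derivations K A P" and "X = shift_map (restr_AP A P X)"
proof -
  define d where "d = restr_AP A P X"
  note L = diolic_derivation_Leibniz[OF X, unfolded koszul_def]
  note lin = diolic_derivation_add[OF X]
  note lins = diolic_derivation_smult[OF X]
  have XA: "X (a, \<zero>\<^bsub>P\<^esub>) = (\<zero>\<^bsub>A\<^esub>, d a)" and dc [simp]: "d a \<in> carrier P" if "a \<in> carrier A" for a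
    using diolic_derivation_grading[OF X, of "(a, \<zero>\<^bsub>P\<^esub>)" 0] that
    by (auto simp: diolic_component_def d_def restr_AP_def)
  have XP: "X (\<zero>\<^bsub>A\<^esub>, p) = (\<zero>\<^bsub>A\<^esub>, \<zero>\<^bsub>P\<^esub>)" if "p \<in> carrier P" for p
    using diolic_derivation_grading[OF X, of "(\<zero>\<^bsub>A\<^esub>, p)" 1] that
    by (auto simp: diolic_component_def)
  have "d \<in> derivations K A P"
    unfolding derivations_def linear_maps_def
  proof (intro CollectI conjI ballI)
    show "d \<in> carrier A \<rightarrow>\<^sub>E carrier (restrict_scalars A P)"
      by (auto simp: restrict_scalars_def) (auto simp: d_def restr_AP_def)
    fix a b assume ab: "a \<in> carrier A" "b \<in> carrier A"
    show "d (a \<oplus>\<^bsub>A\<^esub> b) = d a \<oplus>\<^bsub>restrict_scalars A P\<^esub> d b"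
      using lin[of "(a, \<zero>\<^bsub>P\<^esub>)" "(b, \<zero>\<^bsub>P\<^esub>)"] ab by (simp add: XA diolic_simps restrict_scalars_def)
    show "d (a \<otimes>\<^bsub>A\<^esub> b) = b \<odot>\<^bsub>P\<^esub> d a \<oplus>\<^bsub>P\<^esub> a \<odot>\<^bsub>P\<^esub> d b"
      using L[of "(a, \<zero>\<^bsub>P\<^esub>)" 0 "(b, \<zero>\<^bsub>P\<^esub>)" 0] ab
      by (simp add: XA diolic_simps diolic_component_def)
  next
    fix k a assume "k \<in> carrier K" "a \<in> carrier A"
    then show "d (k \<odot>\<^bsub>A\<^esub> a) = k \<odot>\<^bsub>restrict_scalars A P\<^esub> d a"
      using lins[of "(a, \<zero>\<^bsub>P\<^esub>)" k] by (simp add: XA diolic_simps restrict_scalars_def smult_one_mult)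
  qed
  then show "restr_AP A P X \<in> derivations K A P"
    by (simp add: d_def)
  have "X x = shift_map d x" for x
  proof (cases "x \<in> carrier A \<times> carrier P")
    case True
    then show ?thesis
      using diolic_derivation_split[OF X] by (auto simp: XA XP diolic_simps)
  next
    case False
    then show ?thesis
      using diolic_derivation_undefined[OF X] by auto
  qed
  then show "X = shift_map (restr_AP A P X)"
    by (auto simp flip: d_def)
qed

lemma restr_AP_shift_map: "d \<in> derivations K A P \<Longrightarrow> restr_AP A P (shift_map d) = d"
  by (auto simp: derivations_def linear_maps_def restr_AP_def restrict_scalars_def
      fun_eq_iff restrict_def PiE_def extensional_def)

lemma degree_one_derivations_eq: "diolic_derivations K A P 1 = shift_map ` derivations K A P"
  using degree_one_derivation shift_map_derivation by blast

text \<open>The module operations are carried over from \<open>derivations K A P\<close>: \<open>shift_map\<close> is compatible with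
  sums and multiples, so its image is closed under them.\<close>

lemma module_degree_one: "module A (diolic_derivation_module K A P 1)"
  unfolding diolic_derivation_module_def diolic_simps(1)
proof -
  interpret B: module A "diolic_over A P" by (rule module_diolic_over)
  interpret D: module A "derivation_module K A P"
    by (rule module_derivation_module[OF P.module_axioms])
  have c: "d a \<in> carrier P" if "d \<in> derivations K A P" "a \<in> carrier A" for d a
    using that by (auto simp: derivations_def linear_maps_def restrict_scalars_def)
  show "module A (pointwise_module (carrier A \<times> carrier P) (diolic_over A P) (diolic_derivations K A P 1))"
    unfolding degree_one_derivations_eq
  proof (rule B.module_pointwise_module)
    show "shift_map ` derivations K A P \<subseteq> carrier A \<times> carrier P \<rightarrow>\<^sub>E carrier (diolic_over A P)"
      by (rule image_subsetI, rule PiE_I) (auto simp: diolic_over_simps c)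
    have "(\<lambda>a\<in>carrier A. \<zero>\<^bsub>P\<^esub>) \<in> derivations K A P"
      using D.M.zero_closed by (simp add: derivation_module_def pointwise_module_def)
    then show "(\<lambda>x\<in>carrier A \<times> carrier P. \<zero>\<^bsub>diolic_over A P\<^esub>) \<in> shift_map ` derivations K A P"
      by (rule rev_image_eqI) (auto simp: diolic_over_simps fun_eq_iff restrict_def)
  next
    fix f g assume "f \<in> shift_map ` derivations K A P" "g \<in> shift_map ` derivations K A P"
    then obtain d e where de: "d \<in> derivations K A P" "e \<in> derivations K A P"
      and fg: "f = shift_map d" "g = shift_map e"
      by blast
    have "(\<lambda>a\<in>carrier A. d a \<oplus>\<^bsub>P\<^esub> e a) \<in> derivations K A P"
      using D.M.a_closed[of d e] de by (simp add: derivation_module_def pointwise_module_def)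
    then show "(\<lambda>x\<in>carrier A \<times> carrier P. f x \<oplus>\<^bsub>diolic_over A P\<^esub> g x) \<in> shift_map ` derivations K A P"
      by (rule rev_image_eqI) (auto simp: fg diolic_over_simps fun_eq_iff restrict_def)
  next
    fix r f assume r: "r \<in> carrier A" and "f \<in> shift_map ` derivations K A P"
    then obtain d where d: "d \<in> derivations K A P" and f: "f = shift_map d"
      by blast
    have "(\<lambda>a\<in>carrier A. r \<odot>\<^bsub>P\<^esub> d a) \<in> derivations K A P"
      using D.smult_closed[of r d] r d by (simp add: derivation_module_def pointwise_module_def)
    then show "(\<lambda>x\<in>carrier A \<times> carrier P. r \<odot>\<^bsub>diolic_over A P\<^esub> f x) \<in> shift_map ` derivations K A P"
      by (rule rev_image_eqI) (use r in \<open>auto simp: f diolic_over_simps fun_eq_iff restrict_def\<close>)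
  qed
qed

proposition degree_one_derivations:
  "restrict (restr_AP A P) (diolic_derivations K A P 1)
     \<in> module_isos A (diolic_derivation_module K A P 1) (derivation_module K A P)"
proof -
  let ?\<Phi> = "restrict (restr_AP A P) (diolic_derivations K A P 1)"
  have carr: "carrier (diolic_derivation_module K A P 1) = diolic_derivations K A P 1"
    "carrier (derivation_module K A P) = derivations K A P"
    by (simp_all add: diolic_derivation_module_def derivation_module_def pointwise_module_def)
  interpret D1: module A "diolic_derivation_module K A P 1" by (rule module_degree_one)
  have bij: "bij_betw ?\<Phi> (diolic_derivations K A P 1) (derivations K A P)"
    by (rule bij_betw_byWitness[where f' = shift_map])
      (use degree_one_derivation shift_map_derivation restr_AP_shift_map in auto)
  have "?\<Phi> \<in> linear_maps A (diolic_derivation_module K A P 1) (derivation_module K A P)"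
    unfolding linear_maps_def carr
  proof (intro CollectI conjI ballI)
    show "?\<Phi> \<in> diolic_derivations K A P 1 \<rightarrow>\<^sub>E derivations K A P"
      using degree_one_derivation by auto
    fix X assume X: "X \<in> diolic_derivations K A P 1"
    show "?\<Phi> (X \<oplus>\<^bsub>diolic_derivation_module K A P 1\<^esub> Y) = ?\<Phi> X \<oplus>\<^bsub>derivation_module K A P\<^esub> ?\<Phi> Y"
      if Y: "Y \<in> diolic_derivations K A P 1" for Y
    proof -
      have "?\<Phi> (X \<oplus>\<^bsub>diolic_derivation_module K A P 1\<^esub> Y)
          = restr_AP A P (X \<oplus>\<^bsub>diolic_derivation_module K A P 1\<^esub> Y)"
        using D1.M.a_closed[of X Y] X Y by (simp add: carr)
      also have "\<dots> = ?\<Phi> X \<oplus>\<^bsub>derivation_module K A P\<^esub> ?\<Phi> Y"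
        using X Y by (auto simp: restr_AP_def derivation_module_def diolic_derivation_module_def
            pointwise_module_def diolic_simps fun_eq_iff restrict_def diolic_over_def case_prod_beta)
      finally show ?thesis .
    qed
    show "?\<Phi> (a \<odot>\<^bsub>diolic_derivation_module K A P 1\<^esub> X) = a \<odot>\<^bsub>derivation_module K A P\<^esub> ?\<Phi> X"
      if a: "a \<in> carrier A" for a
    proof -
      have "?\<Phi> (a \<odot>\<^bsub>diolic_derivation_module K A P 1\<^esub> X)
          = restr_AP A P (a \<odot>\<^bsub>diolic_derivation_module K A P 1\<^esub> X)"
        using D1.smult_closed[of a X] X a by (simp add: carr)
      also have "\<dots> = a \<odot>\<^bsub>derivation_module K A P\<^esub> ?\<Phi> X"
        using X by (auto simp: restr_AP_def derivation_module_def diolic_derivation_module_def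
            pointwise_module_def diolic_simps fun_eq_iff restrict_def diolic_over_def case_prod_beta)
      finally show ?thesis .
    qed
  qed
  then show ?thesis
    using bij module_degree_one module_derivation_module[OF P.module_axioms]
    by (simp add: module_isos_def carr)
qed

subsection \<open>The other degrees\<close>

text \<open>Linearity is the Leibniz rule on \<open>A \<cdot> P\<close>, as \<open>X\<close> kills \<open>A\<close>. The symmetry is the Leibniz rule on
  \<open>P \<cdot> P = 0\<close>: there the Koszul sign is \<open>(-1)\<^sup>-\<^sup>1 = -1\<close>.\<close>

lemma degree_minus_one_form:
  assumes X: "X \<in> diolic_derivations K A P (- 1)"
  defines "\<phi> \<equiv> \<lambda>p\<in>carrier P. fst (X (\<zero>\<^bsub>A\<^esub>, p))"
  shows "\<phi> \<in> linear_maps A P (self_module A)"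
    and "\<And>p q. \<lbrakk>p \<in> carrier P; q \<in> carrier P\<rbrakk> \<Longrightarrow> \<phi> p \<odot>\<^bsub>P\<^esub> q = \<phi> q \<odot>\<^bsub>P\<^esub> p"
    and "\<And>p. p \<in> carrier P \<Longrightarrow> X (\<zero>\<^bsub>A\<^esub>, p) = (\<phi> p, \<zero>\<^bsub>P\<^esub>)"
proof -
  note L = diolic_derivation_Leibniz[OF X, unfolded koszul_def]
  note lin = diolic_derivation_add[OF X]
  have XA: "X (a, \<zero>\<^bsub>P\<^esub>) = (\<zero>\<^bsub>A\<^esub>, \<zero>\<^bsub>P\<^esub>)" if "a \<in> carrier A" for a
    using diolic_derivation_grading[OF X, of "(a, \<zero>\<^bsub>P\<^esub>)" 0] that
    by (auto simp: diolic_component_def)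
  have XP: "X (\<zero>\<^bsub>A\<^esub>, p) = (\<phi> p, \<zero>\<^bsub>P\<^esub>)" and \<phi>c [simp]: "\<phi> p \<in> carrier A" if "p \<in> carrier P" for p
    using diolic_derivation_grading[OF X, of "(\<zero>\<^bsub>A\<^esub>, p)" 1] that
    by (auto simp: diolic_component_def \<phi>_def)
  show "X (\<zero>\<^bsub>A\<^esub>, p) = (\<phi> p, \<zero>\<^bsub>P\<^esub>)" if "p \<in> carrier P" for p
    by (rule XP[OF that])
  show "\<phi> \<in> linear_maps A P (self_module A)"
    unfolding linear_maps_def
  proof (intro CollectI conjI ballI)
    show "\<phi> \<in> carrier P \<rightarrow>\<^sub>E carrier (self_module A)"
      by (auto simp: self_module_def) (auto simp: \<phi>_def)
    fix p assume p: "p \<in> carrier P"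
    show "\<phi> (p \<oplus>\<^bsub>P\<^esub> q) = \<phi> p \<oplus>\<^bsub>self_module A\<^esub> \<phi> q" if "q \<in> carrier P" for q
      using lin[of "(\<zero>\<^bsub>A\<^esub>, p)" "(\<zero>\<^bsub>A\<^esub>, q)"] p that by (simp add: XP diolic_simps self_module_simps)
    show "\<phi> (a \<odot>\<^bsub>P\<^esub> p) = a \<odot>\<^bsub>self_module A\<^esub> \<phi> p" if "a \<in> carrier A" for a
      using L[of "(a, \<zero>\<^bsub>P\<^esub>)" 0 "(\<zero>\<^bsub>A\<^esub>, p)" 1] p that
      by (simp add: XA XP diolic_simps self_module_simps diolic_component_def)
  qed
  show "\<phi> p \<odot>\<^bsub>P\<^esub> q = \<phi> q \<odot>\<^bsub>P\<^esub> p" if pq: "p \<in> carrier P" "q \<in> carrier P" for p q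
  proof -
    have "\<zero>\<^bsub>P\<^esub> = \<phi> p \<odot>\<^bsub>P\<^esub> q \<oplus>\<^bsub>P\<^esub> \<ominus>\<^bsub>P\<^esub> (\<phi> q \<odot>\<^bsub>P\<^esub> p)"
      using L[of "(\<zero>\<^bsub>A\<^esub>, p)" 1 "(\<zero>\<^bsub>A\<^esub>, q)" 1] pq
      by (simp add: XA XP diolic_simps diolic_component_def diolic_minus)
    then show ?thesis
      using pq by (metis P.M.minus_minus P.M.minus_equality P.M.a_inv_closed P.smult_closed \<phi>c)
  qed
qed

proposition other_derivations_trivial:
  assumes rank: "has_rank A P r" "r \<noteq> 1" and g: "g \<noteq> 0" "g \<noteq> 1"
  shows "diolic_derivations K A P g = {\<lambda>x\<in>carrier (diolic A P). \<zero>\<^bsub>diolic A P\<^esub>}"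
proof (intro equalityI subsetI)
  fix X assume X: "X \<in> diolic_derivations K A P g"
  have XA: "X (a, \<zero>\<^bsub>P\<^esub>) = (\<zero>\<^bsub>A\<^esub>, \<zero>\<^bsub>P\<^esub>)" if "a \<in> carrier A" for a
    using diolic_derivation_grading[OF X, of "(a, \<zero>\<^bsub>P\<^esub>)" 0] that g
    by (auto simp: diolic_component_def)
  have XP: "X (\<zero>\<^bsub>A\<^esub>, p) = (\<zero>\<^bsub>A\<^esub>, \<zero>\<^bsub>P\<^esub>)" if p: "p \<in> carrier P" for p
  proof (cases "g = - 1")
    case True
    note form = degree_minus_one_form[OF X[unfolded True]]
    show ?thesis
      using P.proportional_form_zero[OF rank form(1) form(2) p] form(3)[OF p] by simp
  next
    case False
    then show ?thesis
      using diolic_derivation_grading[OF X, of "(\<zero>\<^bsub>A\<^esub>, p)" 1] p g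
      by (auto simp: diolic_component_def split: if_splits)
  qed
  have "X x = (\<lambda>x\<in>carrier (diolic A P). \<zero>\<^bsub>diolic A P\<^esub>) x" for x
  proof (cases "x \<in> carrier A \<times> carrier P")
    case True
    then show ?thesis
      using diolic_derivation_split[OF X] by (auto simp: XA XP diolic_simps)
  next
    case False
    then show ?thesis
      using diolic_derivation_undefined[OF X] by (auto simp: diolic_simps)
  qed
  then show "X \<in> {\<lambda>x\<in>carrier (diolic A P). \<zero>\<^bsub>diolic A P\<^esub>}"
    by blast
qed (use zero_diolic_derivation in auto)

end

theorem theorem12:
  fixes K :: "('k, 'm) ring_scheme"
    and A :: "('k, 'a, 'x) module_scheme"
    and P :: "('a, 'p, 'y) module_scheme"
    and r :: nat
  assumes "field K" and "char_zero K"
    and "algebra K A"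
    and "module A P"
    and "has_rank A P r" and "r \<noteq> 1"
  shows "bij_betw (\<lambda>X. (restr_AA A P X, restr_PP A P X))
           (diolic_derivations K A P 0)
           {(d, D). d \<in> derivations K A (self_module A) \<and>
              D \<in> linear_maps K (restrict_scalars A P) (restrict_scalars A P) \<and>
              (\<forall>a\<in>carrier A. \<forall>p\<in>carrier P.
                 D (a \<odot>\<^bsub>P\<^esub> p) = d a \<odot>\<^bsub>P\<^esub> p \<oplus>\<^bsub>P\<^esub> a \<odot>\<^bsub>P\<^esub> D p)}
       \<and> (\<exists>\<Phi>\<in>module_isos A (diolic_derivation_module K A P 1) (derivation_module K A P).
           \<forall>X\<in>diolic_derivations K A P 1. \<Phi> X = restr_AP A P X)
       \<and> (\<forall>g. g \<noteq> 0 \<and> g \<noteq> 1 \<longrightarrow>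
           diolic_derivations K A P g = {\<lambda>x\<in>carrier (diolic A P). \<zero>\<^bsub>diolic A P\<^esub>})"
proof -
  interpret diolic_algebra K A P
    by (intro diolic_algebra.intro assms)
  show ?thesis
    using degree_zero_derivations[unfolded derivation_pairs_def]
      other_derivations_trivial[OF assms(5,6)]
    by (intro conjI bexI[OF _ degree_one_derivations]) simp_all
qed

end
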